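(* (i) For any $d>2$ there exists a constant $\alpha$ large enough such that for any integer $n\ge 1$ and any particle configuration $\eta:\mathbb Z^d\to\mathbb N$ supported in $B_{n/2}$ with $|\eta|\ge\alpha|B_n|$, it holds that $$\mathbb P\big(B_n\not\subseteq\mathsf S(\eta)\big)\le\exp\Big(-C\,\frac{\alpha\cdot n}{\log n\cdot\mathbf 1_{\{d=3\}}+\mathbf 1_{\{d>3\}}}\Big)$$ for some positive and finite constant $C$ depending only on the dimension. (ii) Moreover, for any $d\ge 2$ there exists a constant $\alpha$ large enough such that for any integer $n\ge 1$ and any particle configuration $\eta:\mathbb Z^d\to\mathbb N$ supported in $B_{n/2}$ with $|\eta|\le\alpha\cdot|B_n|$, it holds that $$\mathbb P\big(B_n\not\subseteq\mathsf S(\eta)\big)\ge\exp\big(-c\cdot\alpha\cdot n^{d-2}\big)$$ for some positive and finite constant $c$ depending only on the dimension.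
   Context: $\mathbb N=\{0,1,2,\dots\}$. The offspring distribution $\nu$ is a probability distribution on $\mathbb N$ with $\sum_k k\,\nu(k)=1$, $\sigma^2:=\sum_k (k-1)^2\nu(k)>0$, and $\sum_k e^{\lambda k}\nu(k)<\infty$ for some $\lambda>0$. A particle configuration is a map $\eta:\mathbb Z^d\to\mathbb N$ ($\eta(z)$ is the number of particles at $z$); $|\eta|=\sum_z\eta(z)$ is the total number of particles. For a set $K\subseteq\mathbb Z^d$, $|K|$ is its cardinality. A site $x$ is unstable in $\eta$ if $\eta(x)>1$. Toppling an unstable site $x$ means: remove one particle from $x$, sample $k$ with law $\nu$, and add one particle at each of $x+\xi_1,\dots,x+\xi_k$, where the $\xi_i$ are i.i.d. uniform on the $2d$ unit vectors $\pm e_j$ (all randomness used in different topplings is independent). Starting from a finite configuration $\eta$, repeatedly topple the first unstable site, in a fixed ordering of $\mathbb Z^d$, until no site is unstable; this happens after finitely many topplings almost surely. The final configuration has values in $\{0,1\}$, is identified with its set of occupied sites, and is denoted $\mathsf S(\eta)$ (the stabilization of $\eta$ under internal diffusion limited aggregation with critical branching random walks; its law does not depend on the order of topplings). $\|\cdot\|$ is the Euclidean norm and $B_r=\{z\in\mathbb Z^d:\|z\|<r\}$.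
   Formalization: In (ii), n=1 is allowed only for η=0: if η(0)≥1 then B_1={0} stays occupied and the probability is 0, so the printed bound fails. In (i), for d=3, n=1 (log 1=0) the bound is read as 0. The constants may depend on the fixed law ν as well as on d. *)

theory Defs
  imports "HOL-Probability.Probability"
begin

type_synonym 'd site = "int ^ 'd"
type_synonym 'd config = "'d site \<Rightarrow> nat"

definition lattice_ball :: "real \<Rightarrow> ('d::finite) site set" where
  "lattice_ball \<rho> = {z. norm ((\<chi> i. real_of_int (z $ i)) :: real ^ 'd) < \<rho>}"

definition unit_vectors :: "('d::finite) site set" where
  "unit_vectors = {axis j s | j s. s = 1 \<or> s = - 1}"

text \<open>For configurations of infinite support this sum is 0 by convention; it is only used
  for configurations of finite support.\<close>

definition num_particles :: "('d::finite) config \<Rightarrow> nat" where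
  "num_particles \<eta> = (\<Sum>z | 0 < \<eta> z. \<eta> z)"

definition offspring_law :: "nat pmf \<Rightarrow> bool" where
  "offspring_law \<nu> \<longleftrightarrow>
     (\<lambda>k. real k * pmf \<nu> k) sums 1 \<and>
     (\<Sum>k. (real k - 1)\<^sup>2 * pmf \<nu> k) > 0 \<and>
     (\<exists>l>0. summable (\<lambda>k. exp (l * real k) * pmf \<nu> k))"

text \<open>The randomness of one toppling is the list of the displacements
  \<open>\<xi>\<^sub>1, \<dots>, \<xi>\<^sub>k\<close> of the offspring, whose length \<open>k\<close> has law \<open>\<nu>\<close>.\<close>

definition toppling_pmf :: "nat pmf \<Rightarrow> ('d::finite) site list pmf" where
  "toppling_pmf \<nu> = bind_pmf \<nu> (\<lambda>k. replicate_pmf k (pmf_of_set unit_vectors))"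

definition topple :: "'d site \<Rightarrow> 'd site list \<Rightarrow> ('d::finite) config \<Rightarrow> 'd config" where
  "topple x \<xi>s \<eta> = (\<lambda>z. (\<eta>(x := \<eta> x - 1)) z + count_list (map (\<lambda>\<xi>. x + \<xi>) \<xi>s) z)"

definition unstable :: "('d::finite) config \<Rightarrow> 'd site \<Rightarrow> bool" where
  "unstable \<eta> x \<longleftrightarrow> \<eta> x > 1"

definition stable :: "('d::finite) config \<Rightarrow> bool" where
  "stable \<eta> \<longleftrightarrow> (\<forall>x. \<not> unstable \<eta> x)"

text \<open>The ordering of the sites is a linear order \<open>r\<close>, with \<open>(x, y) \<in> r\<close> meaning that
  \<open>x\<close> comes before or equals \<open>y\<close>. In a finite configuration that is not stable the first unstable
  site exists and is unique.\<close>

definition first_unstable :: "'d site rel \<Rightarrow> ('d::finite) config \<Rightarrow> 'd site" where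
  "first_unstable r \<eta> = (THE x. unstable \<eta> x \<and> (\<forall>y. unstable \<eta> y \<longrightarrow> (x, y) \<in> r))"

text \<open>The toppling number \<open>t\<close> (counted from 0) uses the randomness \<open>\<omega> t\<close>.\<close>

primrec run :: "'d site rel \<Rightarrow> (nat \<Rightarrow> 'd site list) \<Rightarrow> ('d::finite) config \<Rightarrow> nat \<Rightarrow> 'd config" where
  "run r \<omega> \<eta> 0 = \<eta>"
| "run r \<omega> \<eta> (Suc t) =
     (let \<zeta> = run r \<omega> \<eta> t
      in if stable \<zeta> then \<zeta> else topple (first_unstable r \<zeta>) (\<omega> t) \<zeta>)"

text \<open>The value on the event that the procedure never stops is immaterial: for finite \<open>\<eta>\<close>
  this event has probability 0.\<close>

definition stabilization :: "'d site rel \<Rightarrow> ('d::finite) config \<Rightarrow> (nat \<Rightarrow> 'd site list) \<Rightarrow> 'd site set" where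
  "stabilization r \<eta> \<omega> =
     (if \<exists>t. stable (run r \<omega> \<eta> t)
      then {x. run r \<omega> \<eta> (LEAST t. stable (run r \<omega> \<eta> t)) x > 0}
      else {})"

definition toppling_space :: "nat pmf \<Rightarrow> (nat \<Rightarrow> ('d::finite) site list) measure" where
  "toppling_space \<nu> = (\<Pi>\<^sub>M t\<in>UNIV. measure_pmf (toppling_pmf \<nu>))"

definition prob_not_filled :: "nat pmf \<Rightarrow> 'd site rel \<Rightarrow> ('d::finite) config \<Rightarrow> nat \<Rightarrow> real" where
  "prob_not_filled \<nu> r \<eta> n =
     \<P>(\<omega> in toppling_space \<nu>. \<not> lattice_ball (real n) \<subseteq> stabilization r \<eta> \<omega>)"

text \<open>\<open>exp (- a / b)\<close> for \<open>a > 0\<close> and \<open>b \<ge> 0\<close>, read as \<open>exp (- \<infinity>) = 0\<close> if \<open>b = 0\<close>;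
  with \<open>b = log n\<close> the latter happens for \<open>n = 1\<close>. (In HOL, \<open>exp (- a / 0) = 1\<close>.)\<close>

definition exp_neg_quot :: "real \<Rightarrow> real \<Rightarrow> real" where
  "exp_neg_quot a b = (if b = 0 then 0 else exp (- (a / b)))"

end

theory Submission
  imports Defs "HOL-Real_Asymp.Real_Asymp"
begin

text \<open>
  Let \<open>f\<close> be the generating function of the offspring law and \<open>P\<close> the neighbour average on the lattice. For a function \<open>u\<close>
  with values in \<open>[0, 1]\<close>, consider the weight \<open>W(\<eta>) = (\<Prod>x. u x ^ \<eta> x)\<close> of a configuration. Toppling an unstable
  site \<open>x\<close> removes one factor \<open>u x\<close> and multiplies by a new factor of mean \<open>f (P u x)\<close>
  (\<open>nn_integral_weight_topple\<close>). So along the toppling procedure, in whatever order, the mean of \<open>W\<close> increases if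
  \<open>f (P u) \<ge> u\<close> and decreases if \<open>f (P u) \<le> u\<close>. Both parts of the theorem consist in the choice of \<open>u\<close>, with \<open>u z = 0\<close> at a site
  \<open>z\<close> whose emptiness is to be estimated. By criticality, \<open>f (1 - s) = 1 - s + O(s\<^sup>2)\<close> with a strictly positive
  quadratic term, so that for \<open>\<psi> = 1 - u\<close> the conditions compare \<open>P \<psi> - \<psi>\<close> with a multiple of \<open>(P \<psi>)\<^sup>2\<close>.

  For the lower bound on the probability that the ball is not filled, \<open>z\<close> lies in the ball next to its boundary and
  \<open>f (P u) \<ge> u\<close> holds everywhere. As \<open>W\<close> is at most the indicator of \<open>z\<close> being empty, the probability that
  \<open>z\<close> is never occupied is at least the initial weight (\<open>prob_not_filled_ge\<close>). The choice
  \<open>\<psi> = min (1 - f 0) (A / \<parallel>x - z\<parallel>\<^sup>2)\<close> off \<open>z\<close> works for large \<open>A\<close>, since \<open>P \<psi> - \<psi>\<close> is at most of the order of \<open>A\<close> times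
  \<open>\<parallel>x - z\<parallel> powr (-4)\<close> whereas \<open>\<psi>\<^sup>2\<close> grows like \<open>A\<^sup>2\<close> (\<open>supersolution_exists\<close>). The at most \<open>\<alpha> * |B\<^sub>n|\<close> particles at distance of order \<open>n\<close> from \<open>z\<close> give the
  initial weight \<open>exp (- c * \<alpha> * n ^ d / n\<^sup>2)\<close>.

  For the upper bound, \<open>f (P u) \<le> u\<close> holds off \<open>z\<close>; a toppling at \<open>z\<close> leaves the weight 0. A stable configuration has at
  most one particle per site, so if \<open>z\<close> is empty its weight is at least the product of \<open>u\<close> over all sites other than
  \<open>z\<close>. Therefore the probability that \<open>z\<close> ends up empty is at most the initial weight divided by this product
  (\<open>prob_site_empty_le\<close>). Here \<open>\<psi>\<close> is a small multiple of the positive part of \<open>g (x - z) - \<tau>\<close>, where \<open>g\<close> is of order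
  \<open>\<parallel>x\<parallel> powr (1 - d)\<close> and strictly subharmonic off the origin (\<open>potential_exists\<close>), and \<open>\<tau>\<close> is of order \<open>n powr (1 - d)\<close>.
  The initial weight is then at most \<open>exp (- c * \<alpha> * n)\<close>, whereas the product is at least \<open>exp (- c' * n)\<close>, as
  \<open>\<parallel>x\<parallel> powr (1 - d)\<close> sums to the order of \<open>n\<close> over a ball whose radius is proportional to \<open>n\<close>. A union bound over \<open>z\<close>
  yields \<open>exp (- C * \<alpha> * n)\<close> in every dimension \<open>d \<ge> 3\<close>; for \<open>d = 3\<close> this is stronger than the bound with the logarithm,
  up to the constant.

  The upper bound also uses that the procedure stops almost surely. This follows from the same computation with a
  constant \<open>u < 1\<close>, for which the mean weight would grow without bound if topplings went on with positive
  probability (\<open>prob_stabilizes\<close>).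
\<close>

section \<open>The toppling chain\<close>

definition finite_config :: "('d::finite) config \<Rightarrow> bool" where
  "finite_config \<eta> \<longleftrightarrow> finite {x. 0 < \<eta> x}"

definition step :: "'d site rel \<Rightarrow> ('d::finite) config \<Rightarrow> 'd site list \<Rightarrow> 'd config" where
  "step r \<eta> \<xi>s = (if stable \<eta> then \<eta> else topple (first_unstable r \<eta>) \<xi>s \<eta>)"

lemma run_Suc_step: "run r \<omega> \<eta> (Suc t) = step r (run r \<omega> \<eta> t) (\<omega> t)"
  by (simp add: step_def Let_def)

text \<open>
  Conditioning on the first toppling, rather than on the last, is what makes induction over the number of
  topplings work: the remaining run is a run driven by the shifted, independent randomness.
\<close>

lemma run_shift: "run r \<omega> \<eta> (Suc t) = run r (\<lambda>i. \<omega> (Suc i)) (step r \<eta> (\<omega> 0)) t"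
proof (induction t)
  case 0
  show ?case by (simp add: step_def)
next
  case (Suc t)
  have "run r \<omega> \<eta> (Suc (Suc t)) = step r (run r \<omega> \<eta> (Suc t)) (\<omega> (Suc t))"
    by (rule run_Suc_step)
  also have "\<dots> = run r (\<lambda>i. \<omega> (Suc i)) (step r \<eta> (\<omega> 0)) (Suc t)"
    by (simp only: Suc run_Suc_step[of r "\<lambda>i. \<omega> (Suc i)"])
  finally show ?case .
qed

lemma run_stable:
  assumes "stable (run r \<omega> \<eta> t)" "t \<le> t'"
  shows "run r \<omega> \<eta> t' = run r \<omega> \<eta> t"
  using assms(2,1)
  by (induction t' rule: dec_induct) (simp_all del: run.simps add: run_Suc_step step_def)

lemma run_stable_unique:
  "stable (run r \<omega> \<eta> t) \<Longrightarrow> stable (run r \<omega> \<eta> t') \<Longrightarrow> run r \<omega> \<eta> t' = run r \<omega> \<eta> t"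
  by (metis linear run_stable)

lemma subset_stabilization_iff:
  assumes "B \<noteq> {}"
  shows "B \<subseteq> stabilization r \<eta> \<omega> \<longleftrightarrow>
    (\<exists>t. stable (run r \<omega> \<eta> t) \<and> (\<forall>x\<in>B. 0 < run r \<omega> \<eta> t x))"
proof (cases "\<exists>t. stable (run r \<omega> \<eta> t)")
  case True
  then have "stable (run r \<omega> \<eta> (LEAST t. stable (run r \<omega> \<eta> t)))"
    by (rule LeastI_ex)
  then show ?thesis
    using True by (auto simp: stabilization_def dest: run_stable_unique)
next
  case False
  then show ?thesis using assms by (simp add: stabilization_def)
qed

lemma linear_order_finite_least:
  assumes "linear_order r" "finite A" "A \<noteq> {}"
  shows "\<exists>x\<in>A. \<forall>y\<in>A. (x, y) \<in> r"
  using assms(2,3)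
proof (induction A rule: finite_ne_induct)
  case (singleton x)
  then show ?case using assms(1)
    by (auto simp: order_on_defs refl_on_def)
next
  case (insert a A)
  then obtain x where x: "x \<in> A" "\<forall>y\<in>A. (x, y) \<in> r" by blast
  have refl: "(y, y) \<in> r" for y
    using assms(1) by (auto simp: order_on_defs refl_on_def)
  have tot: "(y, w) \<in> r \<or> (w, y) \<in> r" for y w
    using assms(1) refl[of y] by (cases "y = w") (auto simp: order_on_defs total_on_def)
  have tr: "trans r"
    using assms(1) by (auto simp: order_on_defs)
  show ?case
  proof (cases "(x, a) \<in> r")
    case True
    then show ?thesis using x by auto
  next
    case False
    then have "(a, x) \<in> r" using tot by blast
    then show ?thesis using x refl transD[OF tr] by (intro bexI[of _ a]) auto
  qed
qed

lemma unstable_first_unstable: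
  assumes "linear_order r" "finite_config \<eta>" "\<not> stable \<eta>"
  shows "unstable \<eta> (first_unstable r \<eta>)"
proof -
  let ?A = "{x. unstable \<eta> x}"
  have "finite ?A"
    using assms(2) unfolding finite_config_def
    by (rule rev_finite_subset) (auto simp: unstable_def)
  moreover have "?A \<noteq> {}" using assms(3) by (auto simp: stable_def)
  ultimately obtain x where "x \<in> ?A" "\<forall>y\<in>?A. (x, y) \<in> r"
    using linear_order_finite_least[OF assms(1)] by blast
  then have x: "unstable \<eta> x \<and> (\<forall>y. unstable \<eta> y \<longrightarrow> (x, y) \<in> r)" by auto
  have "antisym r" using assms(1) by (auto simp: order_on_defs)
  then have "\<exists>!x. unstable \<eta> x \<and> (\<forall>y. unstable \<eta> y \<longrightarrow> (x, y) \<in> r)"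
    using x by (auto dest: antisymD)
  from theI'[OF this] show ?thesis unfolding first_unstable_def by blast
qed

lemma topple_eq: "topple x \<xi>s \<eta> = (\<lambda>z. (\<eta>(x := \<eta> x - 1)) z + count_list (map ((+) x) \<xi>s) z)"
  by (simp add: topple_def)

lemma finite_config_fewer:
  assumes "finite_config \<eta>"
  shows "finite_config (\<eta>(x := \<eta> x - 1))"
  using assms unfolding finite_config_def by (rule rev_finite_subset) (auto split: if_splits)

lemma finite_config_add_list:
  assumes "finite_config \<eta>"
  shows "finite_config (\<lambda>z. \<eta> z + count_list xs z)"
proof -
  have "{z. 0 < \<eta> z + count_list xs z} \<subseteq> {z. 0 < \<eta> z} \<union> set xs"
    using count_list_0_iff by fastforce
  then show ?thesis
    using assms unfolding finite_config_def by (meson finite_Un finite_set finite_subset)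
qed

lemma finite_config_step: "finite_config \<eta> \<Longrightarrow> finite_config (step r \<eta> \<xi>s)"
  using finite_config_add_list[OF finite_config_fewer[of \<eta> "first_unstable r \<eta>"]]
  by (simp only: step_def topple_eq) simp

lemma finite_config_run: "finite_config \<eta> \<Longrightarrow> finite_config (run r \<omega> \<eta> t)"
  by (induction t) (simp_all del: run.simps(2) add: run_Suc_step finite_config_step)

lemma step_occupied:
  assumes "linear_order r" "finite_config \<eta>" "0 < \<eta> z"
  shows "0 < step r \<eta> \<xi>s z"
  using assms unstable_first_unstable[OF assms(1,2)]
  by (auto simp: step_def topple_def unstable_def)

lemma run_occupied_mono:
  assumes "linear_order r" "finite_config \<eta>" "t \<le> t'" "0 < run r \<omega> \<eta> t z"
  shows "0 < run r \<omega> \<eta> t' z"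
  using assms(3,4)
proof (induction t' rule: dec_induct)
  case (step n)
  then show ?case
    using step_occupied[OF assms(1) finite_config_run[OF assms(2)]]
    by (simp only: run_Suc_step)
qed

section \<open>Product weights of configurations\<close>

text \<open>
  With \<open>u = exp (- \<phi>)\<close> this is the exponential of \<open>- (\<Sum>x. \<phi> x * \<eta> x)\<close>; the product form also admits the
  value \<open>u z = 0\<close>, for which the weight vanishes as soon as \<open>z\<close> is occupied.
\<close>

definition weight :: "('d::finite site \<Rightarrow> real) \<Rightarrow> 'd config \<Rightarrow> real" where
  "weight u \<eta> = (\<Prod>x | 0 < \<eta> x. u x ^ \<eta> x)"

lemma weight_eq_prod:
  assumes "finite A" "{x. 0 < \<eta> x} \<subseteq> A"
  shows "weight u \<eta> = (\<Prod>x\<in>A. u x ^ \<eta> x)"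
  unfolding weight_def using assms by (intro prod.mono_neutral_left) auto

lemma weight_nonneg: "(\<And>x. 0 \<le> u x) \<Longrightarrow> 0 \<le> weight u \<eta>"
  unfolding weight_def by (intro prod_nonneg) auto

lemma weight_le_1: "(\<And>x. 0 \<le> u x) \<Longrightarrow> (\<And>x. u x \<le> 1) \<Longrightarrow> weight u \<eta> \<le> 1"
  unfolding weight_def by (intro prod_le_1) (auto simp: power_le_one)

lemma weight_eq_0:
  assumes "finite_config \<eta>" "u z = 0" "0 < \<eta> z"
  shows "weight u \<eta> = 0"
  using assms unfolding weight_def finite_config_def by (auto intro!: bexI[of _ z])

lemma weight_Suc:
  assumes "finite_config \<eta>"
  shows "weight u (\<eta>(y := Suc (\<eta> y))) = u y * weight u \<eta>"
proof -
  let ?A = "insert y {x. 0 < \<eta> x}"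
  have fin: "finite ?A" using assms by (simp add: finite_config_def)
  have "weight u (\<eta>(y := Suc (\<eta> y))) = (\<Prod>x\<in>?A. u x ^ (\<eta>(y := Suc (\<eta> y))) x)"
    using fin by (intro weight_eq_prod) auto
  also have "\<dots> = u y * (u y ^ \<eta> y * (\<Prod>x\<in>?A - {y}. u x ^ \<eta> x))"
    using fin by (subst prod.remove[of _ y]) (auto intro!: prod.cong)
  also have "u y ^ \<eta> y * (\<Prod>x\<in>?A - {y}. u x ^ \<eta> x) = (\<Prod>x\<in>?A. u x ^ \<eta> x)"
    using fin by (subst (2) prod.remove[of _ y]) auto
  also have "\<dots> = weight u \<eta>" using fin by (intro weight_eq_prod[symmetric]) auto
  finally show ?thesis .
qed

lemma weight_fewer:
  assumes "finite_config \<eta>" "0 < \<eta> x"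
  shows "weight u \<eta> = u x * weight u (\<eta>(x := \<eta> x - 1))"
  using weight_Suc[OF finite_config_fewer[OF assms(1)], of u x x] assms(2) by simp

lemma weight_add_list:
  assumes "finite_config \<eta>"
  shows "weight u (\<lambda>z. \<eta> z + count_list xs z) = prod_list (map u xs) * weight u \<eta>"
proof (induction xs)
  case (Cons a xs)
  have "(\<lambda>z. \<eta> z + count_list (a # xs) z)
      = (\<lambda>z. \<eta> z + count_list xs z)(a := Suc (\<eta> a + count_list xs a))"
    by (auto simp: fun_eq_iff)
  then show ?case
    using weight_Suc[OF finite_config_add_list[OF assms, of xs], of u a] Cons by simp
qed (simp add: weight_def)

lemma weight_topple:
  assumes "finite_config \<eta>"
  shows "weight u (topple x \<xi>s \<eta>) = prod_list (map (\<lambda>\<xi>. u (x + \<xi>)) \<xi>s) * weight u (\<eta>(x := \<eta> x - 1))"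
  using weight_add_list[OF finite_config_fewer[OF assms], of u x "map ((+) x) \<xi>s"]
  by (simp add: topple_eq comp_def)

section \<open>Neighbour averages and the mean effect of a toppling\<close>

text \<open>
  The transition operator of the simple random walk.
\<close>

definition avg :: "('d::finite site \<Rightarrow> real) \<Rightarrow> 'd site \<Rightarrow> real" where
  "avg u x = (\<Sum>e\<in>unit_vectors. u (x + e)) / real (card (unit_vectors :: 'd site set))"

definition pgf :: "nat pmf \<Rightarrow> real \<Rightarrow> real" where
  "pgf \<nu> s = (\<Sum>k. pmf \<nu> k * s ^ k)"

lemma unit_vectors_eq:
  "(unit_vectors :: 'd::finite site set) = (\<lambda>j. axis j 1) ` UNIV \<union> (\<lambda>j. axis j (-1)) ` UNIV"
  by (auto simp: unit_vectors_def)

lemma finite_unit_vectors [simp]: "finite (unit_vectors :: 'd::finite site set)"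
  by (simp add: unit_vectors_eq)

lemma unit_vectors_nonempty [simp]: "(unit_vectors :: 'd::finite site set) \<noteq> {}"
  by (simp add: unit_vectors_eq)

lemma avg_nonneg: "(\<And>x. 0 \<le> u x) \<Longrightarrow> 0 \<le> avg u x"
  unfolding avg_def by (intro divide_nonneg_nonneg sum_nonneg) auto

lemma avg_mono: "(\<And>x. u x \<le> v x) \<Longrightarrow> avg u x \<le> avg v x"
  unfolding avg_def by (intro divide_right_mono sum_mono) auto

lemma avg_const: "avg (\<lambda>_. c) x = c"
proof -
  have "card (unit_vectors :: 'a site set) \<noteq> 0" by (simp add: card_eq_0_iff)
  then show ?thesis by (simp add: avg_def)
qed

lemma avg_le_1: "(\<And>x. u x \<le> 1) \<Longrightarrow> avg u x \<le> 1"
  using avg_mono[of u "\<lambda>_. 1" x] by (simp add: avg_const)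

lemma avg_shift: "avg (\<lambda>x. u (x - z)) x = avg u (x - z)"
  by (simp add: avg_def algebra_simps)

lemma avg_cmult: "avg (\<lambda>x. c * u x) x = c * avg u x"
  by (simp add: avg_def sum_distrib_left)

lemma avg_add: "avg (\<lambda>x. u x + v x) x = avg u x + avg v x"
  by (simp add: avg_def sum.distrib add_divide_distrib)

lemma avg_diff: "avg (\<lambda>x. u x - v x) x = avg u x - avg v x"
  by (simp add: avg_def sum_subtractf diff_divide_distrib)

lemma nn_integral_replicate_unit_vectors:
  fixes u :: "'d::finite site \<Rightarrow> real"
  assumes "\<And>x. 0 \<le> u x"
  shows "(\<integral>\<^sup>+\<xi>s. ennreal (prod_list (map (\<lambda>\<xi>. u (x + \<xi>)) \<xi>s))
      \<partial>replicate_pmf k (pmf_of_set unit_vectors)) = ennreal (avg u x ^ k)"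
proof (induction k)
  case (Suc k)
  have pl: "0 \<le> prod_list (map (\<lambda>\<xi>. u (x + \<xi>)) \<xi>s)" for \<xi>s
    using assms by (induction \<xi>s) auto
  have "(\<integral>\<^sup>+\<xi>s. ennreal (prod_list (map (\<lambda>\<xi>. u (x + \<xi>)) \<xi>s))
      \<partial>replicate_pmf (Suc k) (pmf_of_set unit_vectors))
    = (\<integral>\<^sup>+e. ennreal (u (x + e)) * ennreal (avg u x ^ k) \<partial>pmf_of_set (unit_vectors :: 'd site set))"
    by (simp add: ennreal_mult assms pl nn_integral_cmult Suc)
  also have "\<dots> = (\<integral>\<^sup>+e. ennreal (u (x + e)) \<partial>pmf_of_set (unit_vectors :: 'd site set)) * ennreal (avg u x ^ k)"
    by (simp add: nn_integral_multc)
  also have "(\<integral>\<^sup>+e. ennreal (u (x + e)) \<partial>pmf_of_set (unit_vectors :: 'd site set)) = ennreal (avg u x)"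
    by (simp add: nn_integral_pmf_of_set avg_def sum_ennreal assms ennreal_of_nat_eq_real_of_nat
        divide_ennreal sum_nonneg card_gt_0_iff)
  finally show ?case
    by (simp add: ennreal_mult avg_nonneg assms)
qed simp

lemma summable_pmf_nat: "summable (pmf (\<nu> :: nat pmf))"
  using integrable_pmf[where M = \<nu> and X = UNIV] by (simp add: integrable_count_space_nat_iff)

lemma suminf_pmf_nat: "(\<Sum>k. pmf (\<nu> :: nat pmf) k) = 1"
  using integral_count_space_nat[OF integrable_pmf[where M = \<nu> and X = UNIV]] integral_pmf[where M = \<nu> and X = UNIV] by simp

lemma summable_pgf: "0 \<le> s \<Longrightarrow> s \<le> 1 \<Longrightarrow> summable (\<lambda>k. pmf \<nu> k * s ^ k)"
  by (rule summable_comparison_test'[OF summable_pmf_nat[of \<nu>]])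
    (simp add: mult_left_le power_le_one)

lemma nn_integral_pgf:
  assumes "0 \<le> s" "s \<le> 1"
  shows "(\<integral>\<^sup>+k. ennreal (s ^ k) \<partial>measure_pmf \<nu>) = ennreal (pgf \<nu> s)"
proof -
  have "(\<integral>\<^sup>+k. ennreal (s ^ k) \<partial>measure_pmf \<nu>) = (\<Sum>k. ennreal (pmf \<nu> k * s ^ k))"
    by (simp add: nn_integral_measure_pmf nn_integral_count_space_nat ennreal_mult assms)
  also have "\<dots> = ennreal (pgf \<nu> s)"
    unfolding pgf_def by (intro suminf_ennreal2 summable_pgf assms) (simp add: assms)
  finally show ?thesis .
qed

text \<open>
  A toppling at \<open>x\<close> replaces one factor \<open>u x\<close> of the weight by a product over the offspring. Given their
  number \<open>k\<close>, their positions are independent, so that this product has mean \<open>avg u x ^ k\<close>; averaging over \<open>k\<close>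
  gives the generating function. Hence the sign of \<open>pgf \<nu> (avg u x) - u x\<close> decides whether the weight
  increases or decreases in mean.
\<close>

lemma nn_integral_weight_topple:
  fixes u :: "'d::finite site \<Rightarrow> real"
  assumes "\<And>x. 0 \<le> u x" "\<And>x. u x \<le> 1" "finite_config \<eta>"
  shows "(\<integral>\<^sup>+\<xi>s. ennreal (weight u (topple x \<xi>s \<eta>)) \<partial>toppling_pmf \<nu>)
    = ennreal (weight u (\<eta>(x := \<eta> x - 1)) * pgf \<nu> (avg u x))"
proof -
  have pl: "0 \<le> prod_list (map (\<lambda>\<xi>. u (x + \<xi>)) \<xi>s)" for \<xi>s
    using assms(1) by (induction \<xi>s) auto
  have pg: "0 \<le> pgf \<nu> (avg u x)" unfolding pgf_def
    by (intro suminf_nonneg summable_pgf avg_nonneg avg_le_1 assms) (simp_all add: avg_nonneg assms)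
  show ?thesis
    by (simp add: toppling_pmf_def weight_topple assms ennreal_mult pl weight_nonneg
        nn_integral_multc nn_integral_replicate_unit_vectors nn_integral_pgf avg_nonneg avg_le_1 pg mult.commute)
qed

section \<open>The Markov property of the chain\<close>

lemma prob_space_toppling_space: "prob_space (toppling_space \<nu> :: (nat \<Rightarrow> 'd::finite site list) measure)"
  unfolding toppling_space_def by (intro prob_space_PiM measure_pmf.prob_space_axioms)

lemma space_toppling_space [simp]: "space (toppling_space \<nu>) = UNIV"
  by (simp add: toppling_space_def space_PiM)

lemma measurable_shift:
  "(\<lambda>\<omega> i. \<omega> (Suc i)) \<in> measurable (toppling_space \<nu>) (toppling_space \<nu>)"
  unfolding toppling_space_def by (rule measurable_PiM_single') (auto simp: space_PiM)

lemma measurable_first: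
  "(\<lambda>\<omega>. \<omega> 0) \<in> measurable (toppling_space \<nu>) (count_space UNIV)"
  unfolding toppling_space_def
  using measurable_component_singleton[of 0 UNIV "\<lambda>_. measure_pmf (toppling_pmf \<nu>)"] by simp

text \<open>
  The space of configurations is uncountable, but a run of \<open>t\<close> topplings depends on its randomness only
  through finitely many elements of a countable type. This makes every set of configurations an event.
\<close>

lemma measurable_run [measurable]:
  "(\<lambda>\<omega>. run r \<omega> \<eta> t) \<in> measurable (toppling_space \<nu>) (count_space UNIV)"
proof (induction t arbitrary: \<eta>)
  case (Suc t)
  show ?case
    unfolding run_shift
    by (rule measurable_compose_countable[where g = "\<lambda>\<omega>. \<omega> 0" and
          f = "\<lambda>l \<omega>. run r (\<lambda>i. \<omega> (Suc i)) (step r \<eta> l) t"])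
      (rule measurable_compose[OF measurable_shift Suc] measurable_first)+
qed simp

definition expect_run :: "nat pmf \<Rightarrow> 'd site rel \<Rightarrow> (('d::finite) config \<Rightarrow> ennreal) \<Rightarrow> 'd config \<Rightarrow> nat \<Rightarrow> ennreal" where
  "expect_run \<nu> r h \<eta> t = (\<integral>\<^sup>+\<omega>. h (run r \<omega> \<eta> t) \<partial>toppling_space \<nu>)"

lemma expect_run_0: "expect_run \<nu> r h \<eta> 0 = h \<eta>"
proof -
  interpret prob_space "toppling_space \<nu> :: (nat \<Rightarrow> 'a site list) measure"
    by (rule prob_space_toppling_space)
  show ?thesis by (simp add: expect_run_def emeasure_space_1 flip: space_toppling_space)
qed

lemma expect_run_Suc:
  fixes h :: "'d::finite config \<Rightarrow> ennreal"
  shows "expect_run \<nu> r h \<eta> (Suc t) = (\<integral>\<^sup>+l. expect_run \<nu> r h (step r \<eta> l) t \<partial>toppling_pmf \<nu>)"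
proof -
  let ?M = "measure_pmf (toppling_pmf \<nu> :: 'd site list pmf)"
  let ?S = "toppling_space \<nu> :: (nat \<Rightarrow> 'd site list) measure"
  interpret sequence_space ?M
    by unfold_locales
  have eqS: "S = ?S" by (simp add: toppling_space_def)
  interpret S: prob_space ?S by (rule prob_space_toppling_space)
  have m: "(\<lambda>(s, \<omega>). case_nat s \<omega>) \<in> measurable (?M \<Otimes>\<^sub>M ?S) ?S"
    unfolding toppling_space_def by measurable
  have mr: "(\<lambda>\<omega>. h (run r \<omega> \<eta> (Suc t))) \<in> borel_measurable ?S" for \<eta> t
    by (rule measurable_compose[OF measurable_run]) simp
  have "expect_run \<nu> r h \<eta> (Suc t) = (\<integral>\<^sup>+\<omega>. h (run r \<omega> \<eta> (Suc t)) \<partial>distr (?M \<Otimes>\<^sub>M ?S) ?S (\<lambda>(s, \<omega>). case_nat s \<omega>))"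
    using PiM_iter by (simp only: eqS expect_run_def)
  also have "\<dots> = (\<integral>\<^sup>+p. h (run r (case_nat (fst p) (snd p)) \<eta> (Suc t)) \<partial>(?M \<Otimes>\<^sub>M ?S))"
    using mr m by (subst nn_integral_distr) (auto simp: case_prod_beta)
  also have "\<dots> = (\<integral>\<^sup>+l. \<integral>\<^sup>+\<omega>. h (run r (case_nat l \<omega>) \<eta> (Suc t)) \<partial>?S \<partial>?M)"
    using measurable_compose[OF m mr[of \<eta> t]]
    by (subst S.nn_integral_fst[symmetric]) (auto simp: case_prod_beta simp del: run.simps)
  also have "\<dots> = (\<integral>\<^sup>+l. expect_run \<nu> r h (step r \<eta> l) t \<partial>toppling_pmf \<nu>)"
    unfolding run_shift by (simp add: expect_run_def)
  finally show ?thesis .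
qed

text \<open>
  The other form of the Markov property, with the last toppling split off.
\<close>

lemma expect_run_Suc':
  "expect_run \<nu> r h \<eta> (Suc t) = expect_run \<nu> r (\<lambda>\<zeta>. \<integral>\<^sup>+l. h (step r \<zeta> l) \<partial>toppling_pmf \<nu>) \<eta> t"
proof (induction t arbitrary: \<eta>)
  case 0
  then show ?case by (simp add: expect_run_Suc expect_run_0)
next
  case (Suc t)
  show ?case by (simp add: expect_run_Suc[of \<nu> r h \<eta> "Suc t"] Suc flip: expect_run_Suc)
qed

section \<open>The generating function of a critical offspring law\<close>

lemma pmf_nat_sums: "pmf (\<nu> :: nat pmf) sums 1"
  using summable_sums[OF summable_pmf_nat[of \<nu>]] by (simp add: suminf_pmf_nat)

lemma pgf_mono: "0 \<le> s \<Longrightarrow> s \<le> t \<Longrightarrow> t \<le> 1 \<Longrightarrow> pgf \<nu> s \<le> pgf \<nu> t"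
  unfolding pgf_def by (intro suminf_le summable_pgf mult_left_mono power_mono) auto

lemma pgf_nonneg: "0 \<le> s \<Longrightarrow> s \<le> 1 \<Longrightarrow> 0 \<le> pgf \<nu> s"
  unfolding pgf_def by (intro suminf_nonneg summable_pgf) auto

lemma pgf_1: "pgf \<nu> 1 = 1"
  by (simp add: pgf_def suminf_pmf_nat)

lemma pgf_le_1: "0 \<le> s \<Longrightarrow> s \<le> 1 \<Longrightarrow> pgf \<nu> s \<le> 1"
  using pgf_mono[of s 1 \<nu>] by (simp add: pgf_1)

lemma pgf_0: "pgf \<nu> 0 = pmf \<nu> 0"
  unfolding pgf_def by (subst suminf_finite[of "{0}"]) auto

lemma pmf_0_le_pgf: "0 \<le> s \<Longrightarrow> s \<le> 1 \<Longrightarrow> pmf \<nu> 0 \<le> pgf \<nu> s"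
  using pgf_mono[of 0 s \<nu>] by (simp add: pgf_0)

text \<open>
  A law of mean 1 that charges only \<open>{0, 1}\<close>, or only the positive integers, is the point mass at 1: in either case
  the summands of \<open>\<Sum>k. (k - 1) * pmf \<nu> k = 0\<close> all have the same sign, so they all vanish. That is excluded by the
  positive variance.
\<close>

lemma offspring_law_nontrivial:
  assumes "offspring_law \<nu>"
  shows "0 < pmf \<nu> 0" "\<exists>k\<ge>2. 0 < pmf \<nu> k"
proof -
  let ?d = "\<lambda>k. (real k - 1) * pmf \<nu> k"
  have sums: "?d sums 0"
    using sums_diff[OF _ pmf_nat_sums[of \<nu>], of "\<lambda>k. real k * pmf \<nu> k" 1] assms
    by (simp add: offspring_law_def algebra_simps)
  have nz: "\<exists>k. ?d k \<noteq> 0"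
  proof (rule ccontr)
    assume "\<nexists>k. ?d k \<noteq> 0"
    then have "(real k - 1)\<^sup>2 * pmf \<nu> k = 0" for k
      by (metis mult.assoc mult_zero_right power2_eq_square)
    then have "(\<lambda>k. (real k - 1)\<^sup>2 * pmf \<nu> k) = (\<lambda>_. 0)" by blast
    then show False using assms unfolding offspring_law_def by (simp only:) simp
  qed
  show "0 < pmf \<nu> 0"
  proof (rule ccontr)
    assume "\<not> 0 < pmf \<nu> 0"
    then have "pmf \<nu> 0 = 0" using pmf_nonneg[of \<nu> 0] by linarith
    then have "0 \<le> ?d k" for k by (cases k) auto
    then show False
      using suminf_eq_zero_iff[of ?d] sums nz by (auto simp: sums_iff)
  qed
  show "\<exists>k\<ge>2. 0 < pmf \<nu> k"
  proof (rule ccontr)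
    assume "\<not> (\<exists>k\<ge>2. 0 < pmf \<nu> k)"
    then have z: "pmf \<nu> k = 0" if "k \<ge> 2" for k
    proof -
      have "\<not> 0 < pmf \<nu> k" using \<open>\<not> (\<exists>k\<ge>2. 0 < pmf \<nu> k)\<close> that by blast
      then show ?thesis using pmf_nonneg[of \<nu> k] by linarith
    qed
    have "0 \<le> - ?d k" for k
    proof (cases "k \<ge> 2")
      case False
      then have "k = 0 \<or> k = 1" by auto
      then show ?thesis by auto
    qed (simp add: z)
    then show False
      using suminf_eq_zero_iff[of "\<lambda>k. - ?d k"] sums_minus[OF sums] nz by (auto simp: sums_iff)
  qed
qed

lemma power_one_minus_ge:
  assumes "0 \<le> s" "s \<le> (1::real)" "2 \<le> k"
  shows "1 - real k * s + s\<^sup>2 \<le> (1 - s) ^ k"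
  using assms(3)
proof (induction k rule: dec_induct)
  case base
  show ?case by (simp add: power2_eq_square algebra_simps)
next
  case (step k)
  have "s * (s * s) \<le> real k * (s * s)"
    using assms step by (intro mult_right_mono) auto
  then have "1 - real (Suc k) * s + s\<^sup>2 \<le> (1 - s) * (1 - real k * s + s\<^sup>2)"
    by (simp add: algebra_simps power2_eq_square)
  also have "\<dots> \<le> (1 - s) * (1 - s) ^ k"
    using step assms by (intro mult_left_mono) auto
  finally show ?case by simp
qed

lemma power_one_minus_le:
  assumes "0 \<le> s" "s \<le> (1::real)"
  shows "(1 - s) ^ k \<le> 1 - real k * s + (real k)\<^sup>2 * s\<^sup>2"
proof (induction k)
  case (Suc k)
  have "(1 - s) * (1 - s) ^ k \<le> (1 - s) * (1 - real k * s + (real k)\<^sup>2 * s\<^sup>2)"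
    using Suc assms by (intro mult_left_mono) auto
  also have "\<dots> = 1 - real (Suc k) * s + (real (Suc k))\<^sup>2 * s\<^sup>2 - (real k + 1) * s\<^sup>2 - (real k)\<^sup>2 * (s * s\<^sup>2)"
    by (simp add: algebra_simps power2_eq_square)
  also have "\<dots> \<le> 1 - real (Suc k) * s + (real (Suc k))\<^sup>2 * s\<^sup>2"
  proof -
    have "0 \<le> (real k + 1) * s\<^sup>2" "0 \<le> (real k)\<^sup>2 * (s * s\<^sup>2)" using assms by auto
    then show ?thesis by linarith
  qed
  finally show ?case by simp
qed simp

text \<open>
  By criticality the linear term of the generating function at 1 is that of the identity, so the quadratic
  term, which is strictly positive since some \<open>k \<ge> 2\<close> is charged, decides the comparison with the identity.
  The cap \<open>\<kappa> \<le> 1/4\<close> makes \<open>s - \<kappa> * s\<^sup>2\<close> increasing for \<open>s \<le> 2\<close>.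
\<close>

lemma pgf_lower_bound:
  assumes "offspring_law \<nu>"
  obtains \<kappa> where "0 < \<kappa>" "\<kappa> \<le> 1/4"
    "\<And>s. 0 \<le> s \<Longrightarrow> s \<le> 1 \<Longrightarrow> 1 - s + \<kappa> * s\<^sup>2 \<le> pgf \<nu> (1 - s)"
proof -
  let ?i = "\<lambda>k. pmf \<nu> k * of_bool (2 \<le> k)"
  define \<kappa> where "\<kappa> = suminf ?i"
  have si: "summable ?i"
    by (rule summable_comparison_test'[OF summable_pmf_nat[of \<nu>]]) auto
  obtain k where k: "k \<ge> 2" "0 < pmf \<nu> k" using offspring_law_nontrivial[OF assms] by blast
  have pos: "0 < \<kappa>"
    unfolding \<kappa>_def by (rule suminf_pos2[OF si, of k]) (use k in auto)
  have bound: "1 - s + \<kappa> * s\<^sup>2 \<le> pgf \<nu> (1 - s)" if s: "0 \<le> s" "s \<le> 1" for s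
  proof -
    have A: "(\<lambda>k. pmf \<nu> k - real k * pmf \<nu> k * s + ?i k * s\<^sup>2) sums (1 - 1 * s + \<kappa> * s\<^sup>2)"
      using assms summable_sums[OF si] pmf_nat_sums[of \<nu>]
      unfolding \<kappa>_def offspring_law_def by (intro sums_add sums_diff sums_mult2) auto
    have B: "(\<lambda>k. pmf \<nu> k * (1 - s) ^ k) sums pgf \<nu> (1 - s)"
      unfolding pgf_def using s by (intro summable_sums summable_pgf) auto
    have C: "pmf \<nu> k - real k * pmf \<nu> k * s + ?i k * s\<^sup>2 \<le> pmf \<nu> k * (1 - s) ^ k" for k
    proof -
      have "1 - real k * s + of_bool (2 \<le> k) * s\<^sup>2 \<le> (1 - s) ^ k"
        using power_one_minus_ge[of s k] Bernoulli_inequality[of "- s" k] s by auto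
      from mult_left_mono[OF this pmf_nonneg[of \<nu> k]] show ?thesis
        by (simp add: algebra_simps)
    qed
    from sums_le[OF C A B] show ?thesis by simp
  qed
  have "1 - s + min \<kappa> (1/4) * s\<^sup>2 \<le> pgf \<nu> (1 - s)" if s: "0 \<le> s" "s \<le> 1" for s
    by (rule order_trans[OF _ bound[OF s]]) (simp add: mult_right_mono)
  with that[of "min \<kappa> (1/4)"] pos show ?thesis by auto
qed

text \<open>
  The matching upper bound; it needs a finite second moment, which the exponential moment supplies.
\<close>

lemma pgf_upper_bound:
  assumes "offspring_law \<nu>"
  obtains S where "1 \<le> S"
    "\<And>s. 0 \<le> s \<Longrightarrow> s \<le> 1 \<Longrightarrow> pgf \<nu> (1 - s) \<le> 1 - s + S * s\<^sup>2"
proof -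
  let ?i = "\<lambda>k. pmf \<nu> k * (real k)\<^sup>2"
  obtain l where l: "l > 0" "summable (\<lambda>k. exp (l * real k) * pmf \<nu> k)"
    using assms by (auto simp: offspring_law_def)
  have si: "summable ?i"
  proof (rule summable_comparison_test'[OF summable_mult[OF l(2), of "2 / l\<^sup>2"], where N = 0])
    fix k :: nat
    have "1 + l * real k + (l * real k)\<^sup>2 / 2 \<le> exp (l * real k)"
      by (rule exp_lower_Taylor_quadratic) (use l in auto)
    moreover have "0 \<le> l * real k" using l by simp
    ultimately have "(l * real k)\<^sup>2 / 2 \<le> exp (l * real k)" by linarith
    then have "(real k)\<^sup>2 \<le> 2 / l\<^sup>2 * exp (l * real k)"
      using l by (simp add: field_simps power_mult_distrib)
    from mult_left_mono[OF this pmf_nonneg[of \<nu> k]]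
    show "norm (?i k) \<le> 2 / l\<^sup>2 * (exp (l * real k) * pmf \<nu> k)"
      by (simp add: mult_ac)
  qed
  define S where "S = suminf ?i"
  have bound: "pgf \<nu> (1 - s) \<le> 1 - s + S * s\<^sup>2" if s: "0 \<le> s" "s \<le> 1" for s
  proof -
    have A: "(\<lambda>k. pmf \<nu> k - real k * pmf \<nu> k * s + ?i k * s\<^sup>2) sums (1 - 1 * s + S * s\<^sup>2)"
      using assms summable_sums[OF si] pmf_nat_sums[of \<nu>]
      unfolding S_def offspring_law_def by (intro sums_add sums_diff sums_mult2) auto
    have B: "(\<lambda>k. pmf \<nu> k * (1 - s) ^ k) sums pgf \<nu> (1 - s)"
      unfolding pgf_def using s by (intro summable_sums summable_pgf) auto
    have C: "pmf \<nu> k * (1 - s) ^ k \<le> pmf \<nu> k - real k * pmf \<nu> k * s + ?i k * s\<^sup>2" for k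
      using mult_left_mono[OF power_one_minus_le[OF s, of k] pmf_nonneg[of \<nu> k]]
      by (simp add: algebra_simps)
    from sums_le[OF C B A] show ?thesis by simp
  qed
  have "pgf \<nu> (1 - s) \<le> 1 - s + max S 1 * s\<^sup>2" if s: "0 \<le> s" "s \<le> 1" for s
    by (rule order_trans[OF bound[OF s]]) (simp add: mult_right_mono)
  with that[of "max S 1"] show ?thesis by auto
qed

section \<open>Comparison of mean weights\<close>

lemma nn_integral_step_ge:
  assumes "linear_order r" "finite_config \<eta>" "\<And>x. 0 \<le> u x" "\<And>x. u x \<le> 1"
    and "\<And>x. u x \<le> pgf \<nu> (avg u x)"
  shows "ennreal (weight u \<eta>) \<le> (\<integral>\<^sup>+l. ennreal (weight u (step r \<eta> l)) \<partial>toppling_pmf \<nu>)"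
proof (cases "stable \<eta>")
  case True
  then show ?thesis by (simp add: step_def)
next
  case False
  define x where "x = first_unstable r \<eta>"
  have x: "0 < \<eta> x" using unstable_first_unstable[OF assms(1,2) False] by (simp add: x_def unstable_def)
  have "weight u \<eta> \<le> weight u (\<eta>(x := \<eta> x - 1)) * pgf \<nu> (avg u x)"
    using mult_right_mono[OF assms(5)[of x] weight_nonneg[OF assms(3), where \<eta> = "\<eta>(x := \<eta> x - 1)"]]
    by (simp add: weight_fewer[OF assms(2) x] mult.commute)
  then show ?thesis
    using False by (simp add: step_def nn_integral_weight_topple assms(2-4) ennreal_leI flip: x_def)
qed

lemma expect_run_mono: "(\<And>\<zeta>. g \<zeta> \<le> h \<zeta>) \<Longrightarrow> expect_run \<nu> r g \<eta> t \<le> expect_run \<nu> r h \<eta> t"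
  unfolding expect_run_def by (intro nn_integral_mono)

lemma expect_run_weight_ge:
  assumes "linear_order r" "finite_config \<eta>" "\<And>x. 0 \<le> u x" "\<And>x. u x \<le> 1"
    and "\<And>x. u x \<le> pgf \<nu> (avg u x)"
  shows "ennreal (weight u \<eta>) \<le> expect_run \<nu> r (\<lambda>\<zeta>. ennreal (weight u \<zeta>)) \<eta> t"
  using assms(2)
proof (induction t arbitrary: \<eta>)
  case (Suc t)
  have "ennreal (weight u \<eta>) \<le> (\<integral>\<^sup>+l. ennreal (weight u (step r \<eta> l)) \<partial>toppling_pmf \<nu>)"
    by (rule nn_integral_step_ge) (use assms Suc in auto)
  also have "\<dots> \<le> expect_run \<nu> r (\<lambda>\<zeta>. ennreal (weight u \<zeta>)) \<eta> (Suc t)"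
    unfolding expect_run_Suc using Suc finite_config_step by (intro nn_integral_mono) auto
  finally show ?case .
qed (simp add: expect_run_0)

text \<open>
  The inequality \<open>pgf \<nu> (avg u x) \<le> u x\<close> may fail at \<open>z\<close>: a toppling of \<open>z\<close> happens when \<open>z\<close> holds at least
  two particles and leaves at least one, so the weight is 0 before and after it.
\<close>

lemma nn_integral_step_le:
  assumes "linear_order r" "finite_config \<eta>" "\<And>x. 0 \<le> u x" "\<And>x. u x \<le> 1"
    and "u z = 0" "\<And>x. x \<noteq> z \<Longrightarrow> pgf \<nu> (avg u x) \<le> u x"
  shows "(\<integral>\<^sup>+l. ennreal (weight u (step r \<eta> l)) \<partial>toppling_pmf \<nu>) \<le> ennreal (weight u \<eta>)"
proof (cases "stable \<eta>")
  case True
  then show ?thesis by (simp add: step_def measure_pmf.emeasure_space_1[simplified])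
next
  case False
  define x where "x = first_unstable r \<eta>"
  have x: "1 < \<eta> x" using unstable_first_unstable[OF assms(1,2) False] by (simp add: x_def unstable_def)
  have "weight u (\<eta>(x := \<eta> x - 1)) * pgf \<nu> (avg u x) \<le> weight u \<eta>"
  proof (cases "x = z")
    case True
    have "weight u (\<eta>(x := \<eta> x - 1)) = 0"
      by (rule weight_eq_0[OF finite_config_fewer[OF assms(2)], of u z]) (use x True assms in auto)
    then show ?thesis by (simp add: weight_nonneg assms)
  next
    case False
    then show ?thesis
      using mult_right_mono[OF assms(6)[OF False] weight_nonneg[OF assms(3), where \<eta> = "\<eta>(x := \<eta> x - 1)"]] x
      by (simp add: weight_fewer[OF assms(2), of x] mult.commute)
  qed
  then show ?thesis
    using False by (simp add: step_def nn_integral_weight_topple assms(2-4) ennreal_leI flip: x_def)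
qed

lemma expect_run_weight_le:
  assumes "linear_order r" "finite_config \<eta>" "\<And>x. 0 \<le> u x" "\<And>x. u x \<le> 1"
    and "u z = 0" "\<And>x. x \<noteq> z \<Longrightarrow> pgf \<nu> (avg u x) \<le> u x"
  shows "expect_run \<nu> r (\<lambda>\<zeta>. ennreal (weight u \<zeta>)) \<eta> t \<le> ennreal (weight u \<eta>)"
  using assms(2)
proof (induction t arbitrary: \<eta>)
  case (Suc t)
  have "expect_run \<nu> r (\<lambda>\<zeta>. ennreal (weight u \<zeta>)) \<eta> (Suc t)
      \<le> (\<integral>\<^sup>+l. ennreal (weight u (step r \<eta> l)) \<partial>toppling_pmf \<nu>)"
    unfolding expect_run_Suc using Suc finite_config_step by (intro nn_integral_mono) auto
  also have "\<dots> \<le> ennreal (weight u \<eta>)"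
    by (rule nn_integral_step_le) (use assms Suc in auto)
  finally show ?case .
qed (simp add: expect_run_0)

section \<open>Almost sure stabilization\<close>

lemma run_event_sets [measurable]:
  "{\<omega>. Q (run r \<omega> \<eta> t)} \<in> sets (toppling_space \<nu>)"
  using measurable_sets[OF measurable_run[of r \<eta> t \<nu>], of "{\<zeta>. Q \<zeta>}"] by (simp add: vimage_def)

lemma run_ex_event_sets [measurable]:
  "{\<omega>. \<exists>t. Q (run r \<omega> \<eta> t)} \<in> sets (toppling_space \<nu>)"
proof -
  have "{\<omega>. \<exists>t. Q (run r \<omega> \<eta> t)} = (\<Union>t. {\<omega>. Q (run r \<omega> \<eta> t)})" by auto
  then show ?thesis by (simp only:) measurable
qed

lemma expect_run_of_bool:
  "expect_run \<nu> r (\<lambda>\<zeta>. of_bool (Q \<zeta>)) \<eta> t = ennreal (measure (toppling_space \<nu>) {\<omega>. Q (run r \<omega> \<eta> t)})"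
proof -
  interpret prob_space "toppling_space \<nu> :: (nat \<Rightarrow> 'a site list) measure"
    by (rule prob_space_toppling_space)
  have "expect_run \<nu> r (\<lambda>\<zeta>. of_bool (Q \<zeta>)) \<eta> t
      = (\<integral>\<^sup>+\<omega>. indicator {\<omega>. Q (run r \<omega> \<eta> t)} \<omega> \<partial>toppling_space \<nu>)"
    unfolding expect_run_def by (intro nn_integral_cong) (auto simp: indicator_def)
  then show ?thesis by (simp add: emeasure_eq_measure run_event_sets)
qed

text \<open>
  For an event that persists once it has occurred, bounds at fixed times pass to the event that it ever occurs.
\<close>

lemma prob_run_ex_le:
  assumes "\<And>t. measure (toppling_space \<nu>) {\<omega>. Q (run r \<omega> \<eta> t)} \<le> a"
    and "\<And>\<omega> t. Q (run r \<omega> \<eta> t) \<Longrightarrow> Q (run r \<omega> \<eta> (Suc t))"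
  shows "measure (toppling_space \<nu>) {\<omega>. \<exists>t. Q (run r \<omega> \<eta> t)} \<le> a"
proof -
  interpret prob_space "toppling_space \<nu> :: (nat \<Rightarrow> 'a site list) measure"
    by (rule prob_space_toppling_space)
  have "(\<lambda>t. measure (toppling_space \<nu>) {\<omega>. Q (run r \<omega> \<eta> t)})
      \<longlonglongrightarrow> measure (toppling_space \<nu>) (\<Union>t. {\<omega>. Q (run r \<omega> \<eta> t)})"
    using assms(2) run_event_sets
    by (intro finite_Lim_measure_incseq) (blast intro!: incseq_SucI)+
  then have "measure (toppling_space \<nu>) (\<Union>t. {\<omega>. Q (run r \<omega> \<eta> t)}) \<le> a"
    by (rule LIMSEQ_le_const2) (use assms(1) in auto)
  moreover have "{\<omega>. \<exists>t. Q (run r \<omega> \<eta> t)} = (\<Union>t. {\<omega>. Q (run r \<omega> \<eta> t)})" by auto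
  ultimately show ?thesis by simp
qed

lemma weight_const: "weight (\<lambda>_. c) \<eta> = c ^ num_particles \<eta>"
  by (simp add: weight_def num_particles_def power_sum)

text \<open>
  For a constant \<open>u = c < 1\<close>, strict convexity makes the mean weight grow by a fixed factor at every toppling.
  Since the weight is at most 1, the weight carried by the runs that are still unstable cannot stay bounded below. As the
  mean weight is at least its initial value \<open>c ^ num_particles \<eta>\<close>, the stable runs must carry at least that much
  of it.
\<close>

lemma prob_stabilizes_ge:
  fixes \<eta> :: "'d::finite config"
  assumes "offspring_law \<nu>" "linear_order r" "finite_config \<eta>" "0 < c" "c < 1"
  shows "c ^ num_particles \<eta> \<le> measure (toppling_space \<nu>) {\<omega>. \<exists>t. stable (run r \<omega> \<eta> t)}"
proof (rule ccontr)
  define p where "p = measure (toppling_space \<nu>) {\<omega>. \<exists>t. stable (run r \<omega> \<eta> t)}"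
  define w where "w = weight (\<lambda>_. c) \<eta>"
  assume "\<not> c ^ num_particles \<eta> \<le> measure (toppling_space \<nu>) {\<omega>. \<exists>t. stable (run r \<omega> \<eta> t)}"
  then have pw: "p < w" by (simp add: p_def w_def weight_const)
  have p0: "0 \<le> p" by (simp add: p_def)
  interpret prob_space "toppling_space \<nu> :: (nat \<Rightarrow> 'd site list) measure"
    by (rule prob_space_toppling_space)
  obtain \<kappa> where \<kappa>: "0 < \<kappa>" "\<And>s. 0 \<le> s \<Longrightarrow> s \<le> 1 \<Longrightarrow> 1 - s + \<kappa> * s\<^sup>2 \<le> pgf \<nu> (1 - s)"
    using pgf_lower_bound[OF assms(1)] by metis
  define \<rho> where "\<rho> = \<kappa> * (1 - c)\<^sup>2"
  have \<rho>: "0 < \<rho>" "c + \<rho> \<le> pgf \<nu> c"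
    using \<kappa>(1) \<kappa>(2)[of "1 - c"] assms by (simp_all add: \<rho>_def)
  let ?F = "\<lambda>\<zeta>. ennreal (weight (\<lambda>_. c) \<zeta>)"
  let ?U = "\<lambda>\<zeta>. ?F \<zeta> * of_bool (\<not> stable \<zeta>)"
  have W: "0 \<le> weight (\<lambda>_. c) \<zeta>" "weight (\<lambda>_. c) \<zeta> \<le> 1" for \<zeta> :: "'d config"
    using assms by (auto intro: weight_nonneg weight_le_1)
  have step: "?F \<zeta> + ennreal \<rho> * ?U \<zeta> \<le> (\<integral>\<^sup>+l. ?F (step r \<zeta> l) \<partial>toppling_pmf \<nu>)"
    if fc: "finite_config \<zeta>" for \<zeta>
  proof (cases "stable \<zeta>")
    case True
    then show ?thesis by (simp add: step_def)
  next
    case False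
    define x where "x = first_unstable r \<zeta>"
    define v where "v = weight (\<lambda>_. c) (\<zeta>(x := \<zeta> x - 1))"
    have x: "0 < \<zeta> x" using unstable_first_unstable[OF assms(2) fc False] by (simp add: x_def unstable_def)
    have eq: "weight (\<lambda>_. c) \<zeta> = c * v" unfolding v_def by (rule weight_fewer[OF fc x])
    have v: "0 \<le> v" using W by (simp add: v_def)
    have "c * v + \<rho> * (c * v) \<le> v * pgf \<nu> c"
    proof -
      have "\<rho> * c \<le> \<rho>" using \<rho> assms by simp
      then have "(c + \<rho> * c) * v \<le> pgf \<nu> c * v" using \<rho> v by (intro mult_right_mono) linarith+
      then show ?thesis by (simp add: algebra_simps)
    qed
    then have "ennreal (c * v) + ennreal \<rho> * ennreal (c * v) \<le> ennreal (v * pgf \<nu> c)"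
      using \<rho> v assms by (simp add: ennreal_leI flip: ennreal_mult ennreal_plus)
    then show ?thesis
      using False nn_integral_weight_topple[where u = "\<lambda>_. c" and \<eta> = \<zeta> and x = x and \<nu> = \<nu>] fc assms
      by (simp add: step_def eq v_def avg_const flip: x_def)
  qed
  have U: "ennreal (w - p) \<le> expect_run \<nu> r ?U \<eta> t" for t
  proof -
    have "ennreal w \<le> expect_run \<nu> r ?F \<eta> t"
      unfolding w_def
    proof (rule expect_run_weight_ge)
      show "c \<le> pgf \<nu> (avg (\<lambda>_. c) x)" for x :: "'d site" using \<rho> by (simp add: avg_const)
    qed (use assms in auto)
    also have "\<dots> \<le> expect_run \<nu> r (\<lambda>\<zeta>. ?U \<zeta> + of_bool (stable \<zeta>)) \<eta> t"
      using W by (intro expect_run_mono) auto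
    also have "\<dots> = expect_run \<nu> r ?U \<eta> t + expect_run \<nu> r (\<lambda>\<zeta>. of_bool (stable \<zeta>)) \<eta> t"
      unfolding expect_run_def
      by (intro nn_integral_add) (auto intro!: measurable_compose[OF measurable_run])
    also have "\<dots> \<le> expect_run \<nu> r ?U \<eta> t + ennreal p"
      unfolding expect_run_of_bool p_def
      by (intro add_left_mono ennreal_leI finite_measure_mono run_ex_event_sets) auto
    finally have "ennreal w \<le> expect_run \<nu> r ?U \<eta> t + ennreal p" .
    then have "ennreal w - ennreal p \<le> expect_run \<nu> r ?U \<eta> t"
      by (simp add: ennreal_minus_le_iff add.commute)
    then show ?thesis using p0 by (simp add: ennreal_minus)
  qed
  have "ennreal (real t * (\<rho> * (w - p))) \<le> expect_run \<nu> r ?F \<eta> t" for t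
  proof (induction t)
    case (Suc t)
    have "ennreal (real (Suc t) * (\<rho> * (w - p))) = ennreal (real t * (\<rho> * (w - p))) + ennreal \<rho> * ennreal (w - p)"
    proof -
      have "real (Suc t) * (\<rho> * (w - p)) = real t * (\<rho> * (w - p)) + \<rho> * (w - p)"
        by (simp add: algebra_simps)
      then show ?thesis using pw \<rho> by (simp add: ennreal_mult ennreal_plus)
    qed
    also have "\<dots> \<le> expect_run \<nu> r ?F \<eta> t + ennreal \<rho> * expect_run \<nu> r ?U \<eta> t"
      using Suc U by (intro add_mono mult_left_mono) auto
    also have "\<dots> = expect_run \<nu> r (\<lambda>\<zeta>. ?F \<zeta> + ennreal \<rho> * ?U \<zeta>) \<eta> t"
      unfolding expect_run_def
      by (subst nn_integral_add)
        (auto intro!: measurable_compose[OF measurable_run] nn_integral_cmult[symmetric] arg_cong2[where f = "(+)"])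
    also have "\<dots> \<le> expect_run \<nu> r (\<lambda>\<zeta>. \<integral>\<^sup>+l. ?F (step r \<zeta> l) \<partial>toppling_pmf \<nu>) \<eta> t"
      unfolding expect_run_def by (intro nn_integral_mono step finite_config_run assms)
    finally show ?case by (simp only: expect_run_Suc')
  qed simp
  moreover have "expect_run \<nu> r ?F \<eta> t \<le> 1" for t
  proof -
    have "expect_run \<nu> r ?F \<eta> t \<le> expect_run \<nu> r (\<lambda>\<zeta>. of_bool True) \<eta> t"
      using W by (intro expect_run_mono) auto
    also have "\<dots> \<le> 1" by (simp only: expect_run_of_bool) simp
    finally show ?thesis .
  qed
  ultimately have "ennreal (real t * (\<rho> * (w - p))) \<le> 1" for t by (rule order_trans)
  then have le: "real t * (\<rho> * (w - p)) \<le> 1" for t by (simp add: ennreal_le_1)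
  have "0 < \<rho> * (w - p)" using pw \<rho> by simp
  then obtain t where "1 < real t * (\<rho> * (w - p))" using ex_less_of_nat_mult by blast
  then show False using le[of t] by simp
qed

lemma prob_stabilizes:
  fixes \<eta> :: "'d::finite config"
  assumes "offspring_law \<nu>" "linear_order r" "finite_config \<eta>"
  shows "measure (toppling_space \<nu>) {\<omega>. \<exists>t. stable (run r \<omega> \<eta> t)} = 1"
proof -
  interpret prob_space "toppling_space \<nu> :: (nat \<Rightarrow> 'd site list) measure"
    by (rule prob_space_toppling_space)
  have "(\<lambda>n. (1 - 1 / (real n + 2)) ^ num_particles \<eta>) \<longlonglongrightarrow> (1 - 0) ^ num_particles \<eta>"
    by (intro tendsto_intros) real_asymp
  then have "(1 - 0) ^ num_particles \<eta> \<le> measure (toppling_space \<nu>) {\<omega>. \<exists>t. stable (run r \<omega> \<eta> t)}"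
    by (rule LIMSEQ_le_const2) (auto intro!: exI prob_stabilizes_ge assms)
  then show ?thesis using prob_le_1 by (auto intro: antisym)
qed

lemma prob_never_stabilizes:
  fixes \<eta> :: "'d::finite config"
  assumes "offspring_law \<nu>" "linear_order r" "finite_config \<eta>"
  shows "measure (toppling_space \<nu>) {\<omega>. \<not> (\<exists>t. stable (run r \<omega> \<eta> t))} = 0"
proof -
  interpret prob_space "toppling_space \<nu> :: (nat \<Rightarrow> 'd site list) measure"
    by (rule prob_space_toppling_space)
  have "{\<omega>. \<not> (\<exists>t. stable (run r \<omega> \<eta> t))} = space (toppling_space \<nu>) - {\<omega>. \<exists>t. stable (run r \<omega> \<eta> t)}"
    by auto
  then show ?thesis
    using prob_compl[OF run_ex_event_sets[of stable r \<eta> \<nu>]] prob_stabilizes[OF assms] by simp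
qed

section \<open>Probabilities of empty sites\<close>

text \<open>
  A site also counts as empty when the procedure never stops.
\<close>

definition prob_site_empty :: "nat pmf \<Rightarrow> 'd site rel \<Rightarrow> ('d::finite) config \<Rightarrow> 'd site \<Rightarrow> real" where
  "prob_site_empty \<nu> r \<eta> z = measure (toppling_space \<nu>) {\<omega>. \<not> (\<exists>t. stable (run r \<omega> \<eta> t) \<and> 0 < run r \<omega> \<eta> t z)}"

lemma not_ex_event_sets [measurable]:
  "{\<omega>. \<not> (\<exists>t. Q (run r \<omega> \<eta> t))} \<in> sets (toppling_space \<nu>)"
proof -
  have "{\<omega>. \<not> (\<exists>t. Q (run r \<omega> \<eta> t))} = space (toppling_space \<nu>) - {\<omega>. \<exists>t. Q (run r \<omega> \<eta> t)}" by auto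
  then show ?thesis using run_ex_event_sets by (metis sets.compl_sets)
qed

lemma prob_site_empty_occupied:
  fixes \<eta> :: "'d::finite config"
  assumes "offspring_law \<nu>" "linear_order r" "finite_config \<eta>" "0 < \<eta> z"
  shows "prob_site_empty \<nu> r \<eta> z = 0"
proof -
  have "0 < run r \<omega> \<eta> t z" for \<omega> t
    using run_occupied_mono[OF assms(2,3), of 0 t] assms(4) by simp
  then show ?thesis
    using prob_never_stabilizes[OF assms(1-3)] by (simp add: prob_site_empty_def)
qed

lemma prob_not_filled_eq:
  assumes "(lattice_ball (real n) :: 'd::finite site set) \<noteq> {}"
  shows "prob_not_filled \<nu> r (\<eta> :: 'd config) n = measure (toppling_space \<nu>)
    {\<omega>. \<not> (\<exists>t. stable (run r \<omega> \<eta> t) \<and> (\<forall>x\<in>lattice_ball (real n). 0 < run r \<omega> \<eta> t x))}"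
  using assms by (simp add: prob_not_filled_def subset_stabilization_iff)

lemma prob_not_filled_le_sum:
  fixes \<eta> :: "'d::finite config"
  assumes "(lattice_ball (real n) :: 'd::finite site set) \<noteq> {}" "finite (lattice_ball (real n) :: 'd site set)"
  shows "prob_not_filled \<nu> r \<eta> n \<le> (\<Sum>z\<in>lattice_ball (real n). prob_site_empty \<nu> r \<eta> z)"
proof -
  interpret prob_space "toppling_space \<nu> :: (nat \<Rightarrow> 'd site list) measure"
    by (rule prob_space_toppling_space)
  let ?B = "lattice_ball (real n) :: 'd site set"
  let ?E = "\<lambda>z. {\<omega>. \<not> (\<exists>t. stable (run r \<omega> \<eta> t) \<and> 0 < run r \<omega> \<eta> t z)}"
  have E: "?E z \<in> sets (toppling_space \<nu>)" for z
    by (rule not_ex_event_sets[of "\<lambda>\<zeta>. stable \<zeta> \<and> 0 < \<zeta> z"])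
  have "{\<omega>. \<not> (\<exists>t. stable (run r \<omega> \<eta> t) \<and> (\<forall>x\<in>?B. 0 < run r \<omega> \<eta> t x))} \<subseteq> (\<Union>z\<in>?B. ?E z)"
  proof (rule subsetI, rule ccontr)
    fix \<omega>
    assume a: "\<omega> \<in> {\<omega>. \<not> (\<exists>t. stable (run r \<omega> \<eta> t) \<and> (\<forall>x\<in>?B. 0 < run r \<omega> \<eta> t x))}"
      and b: "\<omega> \<notin> (\<Union>z\<in>?B. ?E z)"
    from b have b': "\<forall>z\<in>?B. \<exists>t. stable (run r \<omega> \<eta> t) \<and> 0 < run r \<omega> \<eta> t z" by auto
    then obtain t where t: "stable (run r \<omega> \<eta> t)" using assms(1) by blast
    have "0 < run r \<omega> \<eta> t x" if "x \<in> ?B" for x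
      using b' that t by (metis run_stable_unique)
    with a t show False by fastforce
  qed
  then have "prob_not_filled \<nu> r \<eta> n \<le> measure (toppling_space \<nu>) (\<Union>z\<in>?B. ?E z)"
    unfolding prob_not_filled_eq[OF assms(1)] using E assms(2)
    by (intro finite_measure_mono) auto
  also have "\<dots> \<le> (\<Sum>z\<in>?B. measure (toppling_space \<nu>) (?E z))"
    using E assms(2) by (intro finite_measure_subadditive_finite) auto
  finally show ?thesis by (simp add: prob_site_empty_def)
qed

text \<open>
  A stable configuration without a particle at \<open>z\<close> has at most one particle at each site and therefore weight at
  least \<open>\<Prod>x\<in>D. u x\<close>, however many particles it has. The mean weight never exceeds its initial value, so Markov's
  inequality bounds the probability of ending in such a configuration; not ending at all has probability 0.
\<close>

lemma prob_site_empty_le: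
  fixes \<eta> :: "'d::finite config"
  assumes "offspring_law \<nu>" "linear_order r" "finite_config \<eta>" "\<And>x. 0 \<le> u x" "\<And>x. u x \<le> 1"
    and "u z = 0" "\<And>x. x \<noteq> z \<Longrightarrow> pgf \<nu> (avg u x) \<le> u x"
    and D: "finite D" "z \<notin> D" "\<And>x. x \<noteq> z \<Longrightarrow> x \<notin> D \<Longrightarrow> u x = 1"
    and q: "0 < q" "q \<le> (\<Prod>x\<in>D. u x)"
  shows "prob_site_empty \<nu> r \<eta> z \<le> weight u \<eta> / q"
proof -
  interpret prob_space "toppling_space \<nu> :: (nat \<Rightarrow> 'd site list) measure"
    by (rule prob_space_toppling_space)
  let ?M = "toppling_space \<nu> :: (nat \<Rightarrow> 'd site list) measure"
  let ?Q = "\<lambda>\<zeta>. finite_config \<zeta> \<and> stable \<zeta> \<and> \<zeta> z = 0"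
  have low: "q \<le> weight u \<zeta>" if "?Q \<zeta>" for \<zeta>
  proof -
    have fin: "finite {x. 0 < \<zeta> x}" using that by (simp add: finite_config_def)
    have "weight u \<zeta> = (\<Prod>x | 0 < \<zeta> x. u x)"
      unfolding weight_def
    proof (rule prod.cong)
      fix x assume "x \<in> {x. 0 < \<zeta> x}"
      moreover have "\<not> 1 < \<zeta> x" using that by (auto simp: stable_def unstable_def)
      ultimately have "\<zeta> x = 1" by simp
      then show "u x ^ \<zeta> x = u x" by simp
    qed simp
    also have "\<dots> = (\<Prod>x\<in>D \<inter> {x. 0 < \<zeta> x}. u x)"
    proof (rule prod.mono_neutral_right)
      show "\<forall>x\<in>{x. 0 < \<zeta> x} - D \<inter> {x. 0 < \<zeta> x}. u x = 1"
        using that D(3) by (metis DiffE IntI mem_Collect_eq less_irrefl)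
    qed (use fin in auto)
    also have "\<dots> \<ge> (\<Prod>x\<in>D. u x)"
    proof -
      have "(\<Prod>x\<in>D. u x) = (\<Prod>x\<in>D \<inter> {x. 0 < \<zeta> x}. u x) * (\<Prod>x\<in>D - {x. 0 < \<zeta> x}. u x)"
        using D by (subst prod.union_disjoint[symmetric]) (auto intro!: prod.cong)
      also have "\<dots> \<le> (\<Prod>x\<in>D \<inter> {x. 0 < \<zeta> x}. u x) * 1"
        using assms by (intro mult_left_mono prod_le_1 prod_nonneg) auto
      finally show ?thesis by simp
    qed
    finally show ?thesis using q by linarith
  qed
  have "measure ?M {\<omega>. ?Q (run r \<omega> \<eta> t)} \<le> weight u \<eta> / q" for t
  proof -
    have "ennreal q * ennreal (measure ?M {\<omega>. ?Q (run r \<omega> \<eta> t)}) = expect_run \<nu> r (\<lambda>\<zeta>. ennreal q * of_bool (?Q \<zeta>)) \<eta> t"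
      unfolding expect_run_of_bool[of \<nu> r ?Q, symmetric] expect_run_def
      by (intro nn_integral_cmult[symmetric] measurable_compose[OF measurable_run]) auto
    also have "\<dots> \<le> expect_run \<nu> r (\<lambda>\<zeta>. ennreal (weight u \<zeta>)) \<eta> t"
      using low by (intro expect_run_mono) (auto intro: ennreal_leI)
    also have "\<dots> \<le> ennreal (weight u \<eta>)"
      by (rule expect_run_weight_le) (use assms in auto)
    finally have "q * measure ?M {\<omega>. ?Q (run r \<omega> \<eta> t)} \<le> weight u \<eta>"
      using q weight_nonneg[of u \<eta>] assms(4) by (simp flip: ennreal_mult)
    then show ?thesis using q by (simp add: field_simps)
  qed
  then have le: "measure ?M {\<omega>. \<exists>t. ?Q (run r \<omega> \<eta> t)} \<le> weight u \<eta> / q"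
    by (rule prob_run_ex_le) (simp only: run_Suc_step finite_config_step, simp add: step_def)
  let ?N = "{\<omega>. \<not> (\<exists>t. stable (run r \<omega> \<eta> t))}"
  have N: "measure ?M ?N = 0" by (rule prob_never_stabilizes[OF assms(1-3)])
  have "prob_site_empty \<nu> r \<eta> z \<le> measure ?M ({\<omega>. \<exists>t. ?Q (run r \<omega> \<eta> t)} \<union> ?N)"
    unfolding prob_site_empty_def
    by (intro finite_measure_mono sets.Un run_ex_event_sets not_ex_event_sets)
      (use finite_config_run[OF assms(3)] in auto)
  also have "\<dots> \<le> measure ?M {\<omega>. \<exists>t. ?Q (run r \<omega> \<eta> t)} + measure ?M ?N"
    by (intro measure_Un_le run_ex_event_sets not_ex_event_sets)
  finally show ?thesis using le N by simp
qed

text \<open>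
  Since \<open>u z = 0\<close>, the weight is at most the indicator of the event that \<open>z\<close> is empty. Its mean is at least its
  initial value, so \<open>z\<close> stays empty forever with at least that probability.
\<close>

lemma prob_not_filled_ge:
  fixes \<eta> :: "'d::finite config"
  assumes "linear_order r" "finite_config \<eta>" "\<And>x. 0 \<le> u x" "\<And>x. u x \<le> 1"
    and "u z = 0" "\<And>x. u x \<le> pgf \<nu> (avg u x)" "z \<in> lattice_ball (real n)"
  shows "weight u \<eta> \<le> prob_not_filled \<nu> r \<eta> n"
proof -
  interpret prob_space "toppling_space \<nu> :: (nat \<Rightarrow> 'd site list) measure"
    by (rule prob_space_toppling_space)
  let ?M = "toppling_space \<nu> :: (nat \<Rightarrow> 'd site list) measure"
  let ?Q = "\<lambda>\<zeta>. finite_config \<zeta> \<and> 0 < \<zeta> z"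
  have "measure ?M {\<omega>. ?Q (run r \<omega> \<eta> t)} \<le> 1 - weight u \<eta>" for t
  proof -
    have "ennreal (weight u \<eta>) \<le> expect_run \<nu> r (\<lambda>\<zeta>. ennreal (weight u \<zeta>)) \<eta> t"
      by (rule expect_run_weight_ge) (use assms in auto)
    also have "\<dots> \<le> expect_run \<nu> r (\<lambda>\<zeta>. of_bool (\<not> ?Q \<zeta>)) \<eta> t"
      using weight_le_1[of u] weight_eq_0[of _ u z] assms by (intro expect_run_mono) auto
    also have "\<dots> = ennreal (measure ?M {\<omega>. \<not> ?Q (run r \<omega> \<eta> t)})"
      by (rule expect_run_of_bool)
    also have "{\<omega>. \<not> ?Q (run r \<omega> \<eta> t)} = space ?M - {\<omega>. ?Q (run r \<omega> \<eta> t)}" by auto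
    also have "measure ?M \<dots> = 1 - measure ?M {\<omega>. ?Q (run r \<omega> \<eta> t)}"
      by (intro prob_compl run_event_sets)
    finally show ?thesis by (simp add: ennreal_le_iff)
  qed
  then have "measure ?M {\<omega>. \<exists>t. ?Q (run r \<omega> \<eta> t)} \<le> 1 - weight u \<eta>"
    by (rule prob_run_ex_le) (simp only: run_Suc_step finite_config_step step_occupied[OF assms(1)])
  then have "weight u \<eta> \<le> measure ?M (space ?M - {\<omega>. \<exists>t. ?Q (run r \<omega> \<eta> t)})"
    by (subst prob_compl) (auto intro: run_ex_event_sets)
  also have "\<dots> \<le> prob_not_filled \<nu> r \<eta> n"
  proof (subst prob_not_filled_eq)
    show "measure ?M (space ?M - {\<omega>. \<exists>t. ?Q (run r \<omega> \<eta> t)}) \<le> measure ?M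
       {\<omega>. \<not> (\<exists>t. stable (run r \<omega> \<eta> t) \<and> (\<forall>x\<in>lattice_ball (real n). 0 < run r \<omega> \<eta> t x))}"
      by (intro finite_measure_mono not_ex_event_sets) (use finite_config_run[OF assms(2)] assms(7) in auto)
  qed (use assms in auto)
  finally show ?thesis .
qed

section \<open>Lattice geometry and radial functions\<close>

text \<open>
  The squared Euclidean norm; a step in direction \<open>j\<close> changes it by \<open>1\<close> plus or minus \<open>2 * x $ j\<close>, which makes neighbour averages of
  its functions computable.
\<close>

definition sqn :: "('d::finite) site \<Rightarrow> real" where
  "sqn x = (\<Sum>i\<in>UNIV. (real_of_int (x $ i))\<^sup>2)"

lemma sqn_nonneg [simp]: "0 \<le> sqn x"
  by (simp add: sqn_def sum_nonneg)

lemma lattice_ball_iff_sqrt: "x \<in> lattice_ball \<rho> \<longleftrightarrow> sqrt (sqn x) < \<rho>"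
  by (simp add: lattice_ball_def norm_vec_def L2_set_def sqn_def)

lemma lattice_ball_iff:
  assumes "0 < \<rho>"
  shows "x \<in> lattice_ball \<rho> \<longleftrightarrow> sqn x < \<rho>\<^sup>2"
  using assms real_sqrt_less_iff[of "sqn x" "\<rho>\<^sup>2"] by (simp add: lattice_ball_iff_sqrt)

lemma sqn_triangle:
  fixes x y :: "'d::finite site"
  shows "sqrt (sqn (x + y)) \<le> sqrt (sqn x) + sqrt (sqn y)"
  using norm_triangle_ineq[of "(\<chi> i. real_of_int (x $ i)) :: real ^ 'd" "\<chi> i. real_of_int (y $ i)"]
  by (simp add: norm_vec_def L2_set_def sqn_def)

lemma sqn_minus [simp]: "sqn (- x) = sqn x"
  by (simp add: sqn_def)

lemma sqn_add_axis: "sqn (x + axis j s) = sqn x + 2 * real_of_int s * real_of_int (x $ j) + (real_of_int s)\<^sup>2"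
proof -
  have "sqn (x + axis j s) = (\<Sum>i\<in>UNIV. (real_of_int (x $ i))\<^sup>2
      + (if i = j then 2 * real_of_int s * real_of_int (x $ j) + (real_of_int s)\<^sup>2 else 0))"
    unfolding sqn_def by (intro sum.cong) (auto simp: axis_def power2_eq_square algebra_simps)
  then show ?thesis by (simp add: sum.distrib sqn_def)
qed

lemma component_le_sqn: "(real_of_int (x $ j))\<^sup>2 \<le> sqn x"
  unfolding sqn_def by (rule member_le_sum) auto

lemma one_le_sqn: "x \<noteq> 0 \<Longrightarrow> 1 \<le> sqn (x :: 'd::finite site)"
proof -
  assume "x \<noteq> 0"
  then obtain j where "x $ j \<noteq> 0" by (auto simp: vec_eq_iff)
  then have "1 \<le> (x $ j)\<^sup>2" by (smt (verit) zero_less_power2)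
  then have "1 \<le> (real_of_int (x $ j))\<^sup>2" by (metis of_int_1_le_iff of_int_power)
  then show ?thesis using component_le_sqn[of x j] by linarith
qed

lemma sum_unit_vectors:
  "(\<Sum>e\<in>(unit_vectors :: 'd::finite site set). f e) = (\<Sum>j\<in>UNIV. f (axis j 1) + f (axis j (-1)))"
proof -
  have "(\<Sum>e\<in>(unit_vectors :: 'd site set). f e)
      = (\<Sum>e\<in>range (\<lambda>j. axis j (1::int)). f e) + (\<Sum>e\<in>range (\<lambda>j. axis j (-1::int)). f e)"
    unfolding unit_vectors_eq by (intro sum.union_disjoint) (auto simp: axis_eq_axis)
  then show ?thesis
    by (simp add: sum.reindex inj_def axis_eq_axis sum.distrib)
qed

lemma card_unit_vectors: "card (unit_vectors :: 'd::finite site set) = 2 * CARD('d)"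
  using sum_unit_vectors[where 'd = 'd, of "\<lambda>_. 1::nat"] by simp

lemma avg_eq:
  "avg u (x :: 'd::finite site) = (\<Sum>j\<in>UNIV. u (x + axis j 1) + u (x + axis j (-1))) / (2 * real CARD('d))"
  by (simp add: avg_def sum_unit_vectors card_unit_vectors)

lemma avg_le:
  assumes "\<And>e. e \<in> unit_vectors \<Longrightarrow> u (x + e) \<le> c"
  shows "avg u (x :: 'd::finite site) \<le> c"
proof -
  have "avg u x \<le> avg (\<lambda>_. c) x"
    unfolding avg_def by (intro divide_right_mono sum_mono assms) auto
  then show ?thesis by (simp add: avg_const)
qed

lemma sqn_neighbour_pos:
  assumes "a\<^sup>2 \<le> s" "s \<noteq> (1::real)" "0 \<le> s"
  shows "0 < s + 1 + 2 * a"
proof -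
  have "0 < (s - 1)\<^sup>2" using assms by simp
  then have "\<bar>2 * a\<bar>\<^sup>2 < (s + 1)\<^sup>2" using assms(1) by (simp add: power2_eq_square algebra_simps)
  then have "\<bar>2 * a\<bar> < s + 1" using assms(3) by (auto intro: power2_less_imp_less[of "\<bar>2 * a\<bar>"])
  then show ?thesis by linarith
qed

text \<open>
  The continuous Laplacian of \<open>\<parallel>x\<parallel> powr (-2)\<close> is at most of order \<open>\<parallel>x\<parallel> powr (-4)\<close>, the square of the function itself.
  This is the scaling of the equation \<open>\<Delta>\<psi> = \<psi>\<^sup>2\<close> for the hitting probability of a critical branching random walk,
  in every dimension. Each antipodal pair of neighbours is bounded by the value that it has when \<open>x\<close> lies on their axis.
\<close>

lemma avg_inverse_sqn_le:
  fixes x :: "'d::finite site"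
  assumes "7 \<le> sqn x"
  shows "avg (\<lambda>x. 1 / sqn x) x \<le> 1 / sqn x + 4 / (sqn x)\<^sup>2"
proof -
  let ?s = "sqn x"
  have pair: "1 / sqn (x + axis j 1) + 1 / sqn (x + axis j (-1)) \<le> 2 * (?s + 1) / (?s - 1)\<^sup>2" for j
  proof -
    define a where "a = real_of_int (x $ j)"
    have a: "a\<^sup>2 \<le> ?s" using component_le_sqn[of x j] by (simp add: a_def)
    have pos: "0 < ?s + 1 + 2 * a" "0 < ?s + 1 - 2 * a"
      using sqn_neighbour_pos[of a ?s] sqn_neighbour_pos[of "- a" ?s] a assms by auto
    have "1 / sqn (x + axis j 1) + 1 / sqn (x + axis j (-1)) = 1 / (?s + 1 + 2 * a) + 1 / (?s + 1 - 2 * a)"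
      by (simp add: sqn_add_axis a_def algebra_simps)
    also have "\<dots> = 2 * (?s + 1) / ((?s + 1 + 2 * a) * (?s + 1 - 2 * a))"
      using pos by (simp add: field_simps)
    also have "(?s + 1 + 2 * a) * (?s + 1 - 2 * a) = (?s + 1)\<^sup>2 - 4 * a\<^sup>2"
      by (simp add: power2_eq_square algebra_simps)
    also have "2 * (?s + 1) / \<dots> \<le> 2 * (?s + 1) / (?s - 1)\<^sup>2"
    proof (rule divide_left_mono)
      show le: "(?s - 1)\<^sup>2 \<le> (?s + 1)\<^sup>2 - 4 * a\<^sup>2" using a by (simp add: power2_eq_square algebra_simps)
      have "0 < (?s - 1)\<^sup>2" using assms by simp
      then show "0 < ((?s + 1)\<^sup>2 - 4 * a\<^sup>2) * (?s - 1)\<^sup>2" using le by (intro mult_pos_pos) linarith+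
    qed (use assms in auto)
    finally show ?thesis .
  qed
  have "avg (\<lambda>x. 1 / sqn x) x \<le> (\<Sum>j\<in>(UNIV :: 'd set). 2 * (?s + 1) / (?s - 1)\<^sup>2) / (2 * real CARD('d))"
    unfolding avg_eq by (intro divide_right_mono sum_mono pair) auto
  also have "\<dots> = (?s + 1) / (?s - 1)\<^sup>2" by (simp add: divide_simps)
  also have "\<dots> \<le> 1 / ?s + 4 / ?s\<^sup>2"
  proof -
    have "?s\<^sup>2 * (?s + 1) \<le> (?s + 4) * (?s - 1)\<^sup>2"
    proof -
      have "(?s + 4) * (?s - 1)\<^sup>2 - ?s\<^sup>2 * (?s + 1) = ?s * (?s - 7) + 4"
        by (simp add: power2_eq_square algebra_simps)
      moreover have "0 \<le> ?s * (?s - 7)" using assms by simp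
      ultimately show ?thesis by linarith
    qed
    then have "(?s + 1) / (?s - 1)\<^sup>2 \<le> (?s + 4) / ?s\<^sup>2"
      using assms by (simp add: divide_le_eq le_divide_eq mult.commute)
    also have "\<dots> = 1 / ?s + 4 / ?s\<^sup>2"
      using assms by (simp add: field_simps power2_eq_square)
    finally show ?thesis .
  qed
  finally show ?thesis .
qed

lemma powr_neg_symmetric_ge_2:
  assumes "0 \<le> t" "t < (1::real)" "0 < q"
  shows "2 \<le> (1 - t) powr (-q) + (1 + t) powr (-q)"
proof -
  let ?a = "(1 - t) powr (-q)" and ?b = "(1 + t) powr (-q)"
  have "t * t \<le> t * 1" using assms by (intro mult_left_mono) auto
  then have "0 < 1 - t\<^sup>2" "1 - t\<^sup>2 \<le> 1" using assms by (simp_all add: power2_eq_square)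
  then have "1 \<le> (1 - t\<^sup>2) powr (-q)" using assms powr_mono2'[of "-q" "1 - t\<^sup>2" 1] by simp
  also have "\<dots> = ?a * ?b" using assms
    by (subst powr_mult[symmetric]) (auto simp: power2_eq_square algebra_simps)
  finally have ab: "1 \<le> ?a * ?b" .
  have "4 * (?a * ?b) \<le> (?a + ?b)\<^sup>2"
    using zero_le_power2[of "?a - ?b"] by (simp add: power2_eq_square algebra_simps)
  then have "2\<^sup>2 \<le> (?a + ?b)\<^sup>2" using ab by simp
  then show ?thesis by (rule power2_le_imp_le) simp
qed

text \<open>
  The even part of the Taylor expansion at 0: the remainder is nonnegative as the second derivative of the right side
  is smallest at 0, by \<open>powr_neg_symmetric_ge_2\<close>.
\<close>

lemma powr_neg_symmetric_ge:
  assumes "\<bar>t\<bar> < (1::real)" "0 < p"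
  shows "2 + p * (p + 1) * t\<^sup>2 \<le> (1 - t) powr (-p) + (1 + t) powr (-p)"
proof -
  have nonneg: "2 + p * (p + 1) * t\<^sup>2 \<le> (1 - t) powr (-p) + (1 + t) powr (-p)"
    if t: "0 \<le> t" "t < 1" for t :: real
  proof -
    define m where "m t = (1 - t) powr (-p-1) - (1 + t) powr (-p-1) - 2 * (p + 1) * t" for t :: real
    have m: "0 \<le> m y" if y: "0 \<le> y" "y < 1" for y
    proof -
      have "m 0 \<le> m y"
      proof (rule DERIV_nonneg_imp_nondecreasing[OF y(1)])
        fix x assume x: "0 \<le> x" "x \<le> y"
        have "(m has_real_derivative (p + 1) * ((1 - x) powr (-p-2) + (1 + x) powr (-p-2) - 2)) (at x)"
          unfolding m_def using x y by (auto intro!: derivative_eq_intros simp: algebra_simps)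
        moreover have "0 \<le> (p + 1) * ((1 - x) powr (-p-2) + (1 + x) powr (-p-2) - 2)"
          using powr_neg_symmetric_ge_2[of x "p + 2"] x y assms by simp
        ultimately show "\<exists>D. (m has_real_derivative D) (at x) \<and> 0 \<le> D" by blast
      qed
      then show ?thesis by (simp add: m_def)
    qed
    define k where "k t = (1 - t) powr (-p) + (1 + t) powr (-p) - p * (p + 1) * t\<^sup>2" for t :: real
    have "k 0 \<le> k t"
    proof (rule DERIV_nonneg_imp_nondecreasing[OF t(1)])
      fix x assume x: "0 \<le> x" "x \<le> t"
      have "(k has_real_derivative p * m x) (at x)"
        unfolding k_def m_def using x t by (auto intro!: derivative_eq_intros simp: algebra_simps)
      moreover have "0 \<le> p * m x" using m[of x] x t assms by simp
      ultimately show "\<exists>D. (k has_real_derivative D) (at x) \<and> 0 \<le> D" by blast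
    qed
    then show ?thesis by (simp add: k_def)
  qed
  show ?thesis
  proof (cases "0 \<le> t")
    case True
    then show ?thesis using nonneg[of t] assms by simp
  next
    case False
    then show ?thesis using nonneg[of "- t"] assms by (simp add: add.commute)
  qed
qed

definition decay :: "real \<Rightarrow> ('d::finite) site \<Rightarrow> real" where
  "decay p x = (1 + sqn x) powr (-p)"

lemma decay_pos: "0 < decay p x"
  using sqn_nonneg[of x] by (simp add: decay_def add_nonneg_eq_0_iff)

lemma decay_le_1: "0 \<le> p \<Longrightarrow> decay p x \<le> 1"
  using powr_mono2'[of "-p" 1 "1 + sqn x"] by (simp add: decay_def)

text \<open>
  The two neighbours of \<open>x\<close> in direction \<open>j\<close> have \<open>1 + sqn\<close> equal to \<open>2 + sqn x\<close> plus and minus \<open>2 * x $ j\<close>.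
  Pairing them cancels the odd terms, and the quadratic terms sum to a multiple of \<open>sqn x\<close>.
\<close>

lemma avg_decay_ge:
  fixes x :: "'d::finite site"
  assumes "0 < p"
  shows "(2 + sqn x) powr (-p) * (1 + 2 * p * (p + 1) / real CARD('d) * (sqn x / (2 + sqn x)\<^sup>2))
    \<le> avg (decay p) x"
proof -
  let ?S = "2 + sqn x"
  let ?t = "\<lambda>j. 2 * real_of_int (x $ j) / ?S"
  have S: "0 < ?S" using sqn_nonneg[of x] by linarith
  have pair: "?S powr (-p) * (2 + p * (p + 1) * (?t j)\<^sup>2)
      \<le> decay p (x + axis j 1) + decay p (x + axis j (-1))" for j
  proof -
    define a where "a = real_of_int (x $ j)"
    have a: "a\<^sup>2 \<le> sqn x" using component_le_sqn[of x j] by (simp add: a_def)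
    have "2 * \<bar>a\<bar> \<le> 1 + a\<^sup>2" using zero_le_power2[of "\<bar>a\<bar> - 1"] by (simp add: power2_diff)
    then have t: "2 * \<bar>a\<bar> < ?S" using a by linarith
    then have "\<bar>?t j\<bar> < 1" using S by (simp add: a_def)
    from mult_left_mono[OF powr_neg_symmetric_ge[OF this assms], of "?S powr (-p)"]
    have "?S powr (-p) * (2 + p * (p + 1) * (?t j)\<^sup>2)
        \<le> ?S powr (-p) * (1 - ?t j) powr (-p) + ?S powr (-p) * (1 + ?t j) powr (-p)"
      by (simp add: algebra_simps)
    also have "?S powr (-p) * (1 - ?t j) powr (-p) = (?S * (1 - ?t j)) powr (-p)"
      by (rule powr_mult[symmetric])
    also have "?S powr (-p) * (1 + ?t j) powr (-p) = (?S * (1 + ?t j)) powr (-p)"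
      by (rule powr_mult[symmetric])
    also have "?S * (1 - ?t j) = ?S - 2 * a"
      using S by (simp add: a_def right_diff_distrib)
    also have "?S * (1 + ?t j) = ?S + 2 * a"
      using S by (simp add: a_def distrib_left)
    finally show ?thesis
      by (simp add: decay_def sqn_add_axis a_def algebra_simps)
  qed
  have "(\<Sum>j\<in>(UNIV :: 'd set). (?t j)\<^sup>2) = 4 * (sqn x / ?S\<^sup>2)"
    by (simp add: sqn_def power_divide power_mult_distrib sum_distrib_left sum_divide_distrib)
  then have "(\<Sum>j\<in>(UNIV :: 'd set). ?S powr (-p) * (2 + p * (p + 1) * (?t j)\<^sup>2))
      = ?S powr (-p) * (2 * real CARD('d) + p * (p + 1) * (4 * (sqn x / ?S\<^sup>2)))"
    by (simp only: sum_distrib_left[symmetric] sum.distrib sum_constant) (simp add: mult.commute)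
  moreover have "(2 * real CARD('d) + p * (p + 1) * (4 * (sqn x / ?S\<^sup>2))) / (2 * real CARD('d))
      = 1 + 2 * p * (p + 1) / real CARD('d) * (sqn x / ?S\<^sup>2)"
    by (simp add: add_divide_distrib)
  ultimately have "?S powr (-p) * (1 + 2 * p * (p + 1) / real CARD('d) * (sqn x / ?S\<^sup>2))
      = (\<Sum>j\<in>(UNIV :: 'd set). ?S powr (-p) * (2 + p * (p + 1) * (?t j)\<^sup>2)) / (2 * real CARD('d))"
    by (metis times_divide_eq_right)
  also have "\<dots> \<le> avg (decay p) x"
    unfolding avg_eq by (intro divide_right_mono sum_mono pair) auto
  finally show ?thesis .
qed

text \<open>
  Passing from \<open>s\<close> to \<open>1 + s\<close> loses \<open>p / s\<close>, relative to \<open>s powr (-p)\<close>, and the second-order term gains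
  \<open>\<beta> / s\<close>. For \<open>\<beta> = 2 * p * (p + 1) / d\<close> the condition \<open>p < \<beta>\<close> says \<open>2 * p > d - 2\<close>: then \<open>\<parallel>x\<parallel> powr (-2 * p)\<close>
  decays faster than the Green function and is strictly subharmonic.
\<close>

lemma decay_radial_gap:
  fixes p \<beta> :: real
  assumes "0 < p" "p < \<beta>"
  obtains s0 where "1 \<le> s0" "\<And>s. s0 \<le> s \<Longrightarrow>
    s powr (-p) + (\<beta> - p) / 2 * s powr (-p-1) \<le> (1 + s) powr (-p) * (1 + \<beta> * ((s - 1) / (1 + s)\<^sup>2))"
proof -
  have "((\<lambda>s::real. s * ((1 - p / s) * (1 + \<beta> * ((s - 1) / (1 + s)\<^sup>2)) - 1)) \<longlongrightarrow> \<beta> - p) at_top"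
    by real_asymp
  then have "eventually (\<lambda>s. (\<beta> - p) / 2 < s * ((1 - p / s) * (1 + \<beta> * ((s - 1) / (1 + s)\<^sup>2)) - 1)) at_top"
    by (rule order_tendstoD) (use assms in simp)
  then obtain s1 where s1: "\<And>s. s1 \<le> s \<Longrightarrow> (\<beta> - p) / 2 < s * ((1 - p / s) * (1 + \<beta> * ((s - 1) / (1 + s)\<^sup>2)) - 1)"
    by (auto simp: eventually_at_top_linorder)
  have "s powr (-p) + (\<beta> - p) / 2 * s powr (-p-1) \<le> (1 + s) powr (-p) * (1 + \<beta> * ((s - 1) / (1 + s)\<^sup>2))"
    if s: "max s1 1 \<le> s" for s
  proof -
    let ?b = "1 + \<beta> * ((s - 1) / (1 + s)\<^sup>2)"
    have pos: "0 < s" "1 \<le> s" using s by auto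
    have b: "0 \<le> ?b" using pos assms by (intro add_nonneg_nonneg mult_nonneg_nonneg divide_nonneg_nonneg) auto
    have "1 - p / s \<le> (1 + 1 / s) powr (-p)"
    proof -
      have "ln (1 + 1 / s) \<le> 1 / s" using pos by (intro ln_add_one_self_le_self) auto
      then have "p * ln (1 + 1 / s) \<le> p * (1 / s)" using assms by (intro mult_left_mono) auto
      moreover have "1 + (- (p * ln (1 + 1 / s))) \<le> exp (- (p * ln (1 + 1 / s)))" by (rule exp_ge_add_one_self)
      moreover have "0 < 1 + 1 / s" using pos by (simp add: add_pos_pos)
      ultimately show ?thesis by (simp add: powr_def)
    qed
    then have "(1 - p / s) * ?b \<le> (1 + 1 / s) powr (-p) * ?b" by (intro mult_right_mono b)
    moreover have "(\<beta> - p) / 2 / s \<le> (1 - p / s) * ?b - 1"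
      using s1[of s] s pos by (simp add: field_simps)
    ultimately have "1 + (\<beta> - p) / 2 / s \<le> (1 + 1 / s) powr (-p) * ?b" by linarith
    from mult_left_mono[OF this, of "s powr (-p)"]
    have "s powr (-p) * (1 + (\<beta> - p) / 2 / s) \<le> s powr (-p) * (1 + 1 / s) powr (-p) * ?b"
      by (simp add: mult.assoc)
    also have "s powr (-p) * (1 + 1 / s) powr (-p) = (s * (1 + 1 / s)) powr (-p)"
      by (rule powr_mult[symmetric])
    also have "s * (1 + 1 / s) = 1 + s"
      using pos by (simp add: distrib_left)
    also have "s powr (-p) * (1 + (\<beta> - p) / 2 / s) = s powr (-p) + (\<beta> - p) / 2 * s powr (-p-1)"
      using pos by (simp add: powr_diff field_simps)
    finally show ?thesis .
  qed
  then show ?thesis using that[of "max s1 1"] by auto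
qed

lemma avg_decay_le:
  fixes x :: "'d::finite site"
  assumes "0 < p"
  shows "avg (decay p) x \<le> 3 powr p * decay p x"
proof (rule avg_le)
  fix e :: "'d site" assume "e \<in> unit_vectors"
  then obtain j s where e: "e = axis j s" "s = 1 \<or> s = -1" by (auto simp: unit_vectors_def)
  define a where "a = real_of_int (x $ j)"
  have a: "a\<^sup>2 \<le> sqn x" using component_le_sqn[of x j] by (simp add: a_def)
  have "6 * \<bar>a\<bar> \<le> 2 * a\<^sup>2 + 5"
    using zero_le_power2[of "2 * \<bar>a\<bar> - 3"] by (simp add: power2_diff power_mult_distrib)
  then have "1 + sqn x \<le> 3 * (1 + sqn (x + e))"
    using a e by (auto simp: sqn_add_axis a_def abs_if split: if_splits)
  then have "(3 * (1 + sqn (x + e))) powr (-p) \<le> (1 + sqn x) powr (-p)"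
    using assms sqn_nonneg[of x] by (intro powr_mono2') (auto simp: add_pos_nonneg)
  then have "3 powr (-p) * decay p (x + e) \<le> decay p x"
    by (simp only: decay_def powr_mult)
  from mult_left_mono[OF this, of "3 powr p"]
  show "decay p (x + e) \<le> 3 powr p * decay p x"
    by (simp add: powr_minus field_simps)
qed

section \<open>A strictly subharmonic potential in dimension at least three\<close>

text \<open>
  The sum norm, which is the graph distance to the origin.
\<close>

definition l1 :: "('d::finite) site \<Rightarrow> nat" where
  "l1 x = (\<Sum>i\<in>UNIV. nat \<bar>x $ i\<bar>)"

lemma l1_add_axis:
  "l1 (x + axis j s) + nat \<bar>x $ j\<bar> = l1 x + nat \<bar>x $ j + s\<bar>"
proof -
  have "l1 (x + axis j s) = nat \<bar>x $ j + s\<bar> + (\<Sum>i\<in>UNIV - {j}. nat \<bar>x $ i\<bar>)"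
    unfolding l1_def by (subst sum.remove[of _ j]) (auto simp: axis_def intro!: sum.cong)
  moreover have "l1 x = nat \<bar>x $ j\<bar> + (\<Sum>i\<in>UNIV - {j}. nat \<bar>x $ i\<bar>)"
    unfolding l1_def by (subst sum.remove[of _ j]) auto
  ultimately show ?thesis by simp
qed

lemma l1_neighbour:
  assumes "e \<in> unit_vectors"
  shows "l1 x \<le> Suc (l1 (x + e))"
proof -
  obtain j s where "e = axis j s" "s = 1 \<or> s = -1" using assms by (auto simp: unit_vectors_def)
  then show ?thesis using l1_add_axis[of x j s] by auto
qed

lemma l1_descent:
  assumes "x \<noteq> 0"
  obtains e where "e \<in> unit_vectors" "Suc (l1 (x + e)) = l1 x"
proof -
  obtain j where "x $ j \<noteq> 0" using assms by (auto simp: vec_eq_iff)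
  then have "Suc (l1 (x + axis j (- sgn (x $ j)))) = l1 x"
    using l1_add_axis[of x j "- sgn (x $ j)"] by (auto simp: sgn_if split: if_splits)
  moreover have "axis j (- sgn (x $ j)) \<in> unit_vectors"
    using \<open>x $ j \<noteq> 0\<close> by (auto simp: unit_vectors_def sgn_if)
  ultimately show ?thesis using that by blast
qed

lemma l1_le_sqn: "real (l1 x) \<le> sqn x"
  unfolding l1_def sqn_def of_nat_sum
proof (rule sum_mono)
  fix i
  have "\<bar>x $ i\<bar> \<le> (x $ i)\<^sup>2" using self_le_power[of "\<bar>x $ i\<bar>" 2] by (cases "x $ i = 0") auto
  then have "real_of_int \<bar>x $ i\<bar> \<le> real_of_int ((x $ i)\<^sup>2)" by linarith
  then show "real (nat \<bar>x $ i\<bar>) \<le> (real_of_int (x $ i))\<^sup>2" by simp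
qed

lemma sqn_le_l1: "sqn x \<le> (real (l1 x))\<^sup>2"
proof -
  have "sqrt (sqn x) \<le> (\<Sum>i\<in>UNIV. \<bar>real_of_int (x $ i)\<bar>)"
    using L2_set_le_sum_abs[of "\<lambda>i. real_of_int (x $ i)" UNIV] by (simp add: L2_set_def sqn_def)
  also have "\<dots> = real (l1 x)" by (simp add: l1_def)
  finally have "(sqrt (sqn x))\<^sup>2 \<le> (real (l1 x))\<^sup>2" by (intro power_mono) auto
  then show ?thesis by simp
qed

lemma avg_l1_power_le:
  assumes "0 < \<epsilon>" "\<epsilon> \<le> 1"
  shows "avg (\<lambda>x. \<epsilon> ^ l1 x) x \<le> \<epsilon> ^ l1 x / \<epsilon>"
proof (rule avg_le)
  fix e assume "e \<in> (unit_vectors :: 'a site set)"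
  then have "\<epsilon> ^ Suc (l1 (x + e)) \<le> \<epsilon> ^ l1 x"
    using assms by (intro power_decreasing l1_neighbour) auto
  then show "\<epsilon> ^ l1 (x + e) \<le> \<epsilon> ^ l1 x / \<epsilon>" using assms by (simp add: field_simps)
qed

text \<open>
  Some neighbour of \<open>x\<close> is closer to the origin. When \<open>\<epsilon>\<close> is small, its value alone makes the average
  exceed \<open>\<epsilon> ^ l1 x\<close> by any prescribed factor.
\<close>

lemma avg_l1_power_ge:
  fixes x :: "'d::finite site"
  assumes "0 < \<epsilon>" "x \<noteq> 0"
  shows "\<epsilon> ^ l1 x / (2 * real CARD('d) * \<epsilon>) \<le> avg (\<lambda>x. \<epsilon> ^ l1 x) x"
proof -
  obtain e where e: "e \<in> unit_vectors" "Suc (l1 (x + e)) = l1 x" using l1_descent[OF assms(2)] .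
  have "\<epsilon> ^ l1 x = \<epsilon> * \<epsilon> ^ l1 (x + e)" by (metis e(2) power_Suc)
  then have "\<epsilon> ^ l1 x / (2 * real CARD('d) * \<epsilon>) = \<epsilon> ^ l1 (x + e) / (2 * real CARD('d))"
    using assms by simp
  also have "\<dots> \<le> avg (\<lambda>x. \<epsilon> ^ l1 x) x"
    unfolding avg_def card_unit_vectors using assms e
    by (simp, intro divide_right_mono member_le_sum) auto
  finally show ?thesis .
qed

lemma l1_power_le_decay:
  assumes "0 < \<epsilon>" "\<epsilon> < 1" "0 < p"
  shows "\<exists>C>0. \<forall>x :: 'd::finite site. \<epsilon> ^ l1 x \<le> C * decay p x"
proof -
  have "(\<lambda>m::nat. (1 + real m) powr (2 * p) * \<epsilon> ^ m) \<longlonglongrightarrow> 0"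
    using assms by real_asymp
  then have "Bseq (\<lambda>m::nat. (1 + real m) powr (2 * p) * \<epsilon> ^ m)"
    using convergentI convergent_imp_Bseq by blast
  then obtain C where C: "0 < C" "\<And>m::nat. norm ((1 + real m) powr (2 * p) * \<epsilon> ^ m) \<le> C"
    by (auto simp: Bseq_def)
  have "\<epsilon> ^ l1 x \<le> C * decay p x" for x :: "'d site"
  proof -
    let ?m = "l1 x"
    have s: "0 < 1 + sqn x" using sqn_nonneg[of x] by linarith
    have "1 + sqn x \<le> (1 + real ?m)\<^sup>2" using sqn_le_l1[of x] by (simp add: power2_eq_square algebra_simps)
    then have "(1 + sqn x) powr p \<le> ((1 + real ?m)\<^sup>2) powr p" using assms s by (intro powr_mono2) auto
    also have "\<dots> = (1 + real ?m) powr (2 * p)"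
      by (simp add: powr_powr flip: powr_numeral)
    finally have "(1 + sqn x) powr p * \<epsilon> ^ ?m \<le> (1 + real ?m) powr (2 * p) * \<epsilon> ^ ?m"
      using assms by (intro mult_right_mono) auto
    also have "\<dots> \<le> C" using C(2)[of ?m] by simp
    finally show ?thesis using s by (simp add: decay_def powr_minus field_simps)
  qed
  with C show ?thesis by blast
qed

text \<open>
  The potential behind the upper bound. The function \<open>\<parallel>x\<parallel> powr (1 - d)\<close> decays a little faster than the Green
  function, so it is subharmonic with a gap of order \<open>\<parallel>x\<parallel> powr (-1 - d)\<close>. This dominates its square, of order
  \<open>\<parallel>x\<parallel> powr (2 - 2 * d)\<close>, exactly when \<open>d \<ge> 3\<close>. On the lattice the gap exists only far from the origin; near it
  a large multiple of the strongly subharmonic function \<open>\<epsilon> ^ l1 x\<close> repairs the defect, and as this function decays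
  exponentially it does not change the order of \<open>g\<close>.
\<close>

lemma potential_exists:
  assumes "CARD('d::finite) > 2" and p_def: "p = (real CARD('d::finite) - 1) / 2"
  obtains g :: "'d::finite site \<Rightarrow> real" and \<delta> C where "0 < \<delta>" "1 \<le> C"
    "\<And>x. x \<noteq> 0 \<Longrightarrow> g x + \<delta> * (avg g x)\<^sup>2 \<le> avg g x"
    "\<And>x. decay p x \<le> g x" "\<And>x. g x \<le> C * decay p x"
proof -
  let ?d = "real CARD('d)"
  have d: "3 \<le> ?d" using assms by simp
  have p: "1 \<le> p" using d by (simp add: p_def)
  define \<beta> where "\<beta> = 2 * p * (p + 1) / ?d"
  have "\<beta> - p = (?d - 1) / (2 * ?d)" using d by (simp add: \<beta>_def p_def field_simps)
  moreover have "0 < (?d - 1) / (2 * ?d)" using d by simp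
  ultimately have \<beta>: "p < \<beta>" by linarith
  have p0: "0 < p" using p by simp
  obtain s0 where s0: "1 \<le> s0" "\<And>s. s0 \<le> s \<Longrightarrow>
    s powr (-p) + (\<beta> - p) / 2 * s powr (-p-1) \<le> (1 + s) powr (-p) * (1 + \<beta> * ((s - 1) / (1 + s)\<^sup>2))"
    using decay_radial_gap[OF p0 \<beta>] by metis
  define \<kappa> where "\<kappa> = (\<beta> - p) / 2"
  have \<kappa>: "0 < \<kappa>" using \<beta> by (simp add: \<kappa>_def)
  have far: "decay p x + \<kappa> * (decay p x / (1 + sqn x)) \<le> avg (decay p) x" if x: "s0 \<le> 1 + sqn x" for x :: "'d site"
  proof -
    have "decay p x + \<kappa> * (decay p x / (1 + sqn x))
        = (1 + sqn x) powr (-p) + (\<beta> - p) / 2 * (1 + sqn x) powr (-p-1)"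
      using x s0(1) by (simp add: decay_def \<kappa>_def powr_diff)
    also have "\<dots> \<le> (2 + sqn x) powr (-p) * (1 + \<beta> * (sqn x / (2 + sqn x)\<^sup>2))"
      using s0(2)[OF x] by (simp add: add.assoc[symmetric])
    also have "\<dots> \<le> avg (decay p) x"
      using avg_decay_ge[of p x] p by (simp add: \<beta>_def)
    finally show ?thesis .
  qed
  define \<epsilon> where "\<epsilon> = 1 / (4 * ?d)"
  have \<epsilon>: "0 < \<epsilon>" "\<epsilon> < 1" "2 * ?d * \<epsilon> = 1/2" using d by (simp_all add: \<epsilon>_def field_simps)
  define h :: "'d site \<Rightarrow> real" where "h = (\<lambda>x. \<epsilon> ^ l1 x)"
  have h: "0 < h x" "h x \<le> 1" "avg h x \<le> h x / \<epsilon>" for x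
    using \<epsilon> avg_l1_power_le[of \<epsilon> x] by (auto simp: h_def power_le_one)
  have h2: "2 * h x \<le> avg h x" if "x \<noteq> 0" for x
    using avg_l1_power_ge[OF \<epsilon>(1) that] \<epsilon>(3) by (simp add: h_def)
  obtain m :: nat where m: "s0 \<le> real m" using real_arch_simple by blast
  define M where "M = 2 / \<epsilon> ^ m"
  have M: "0 < M" "2 \<le> M" using \<epsilon> by (auto simp: M_def field_simps power_le_one)
  have near: "2 \<le> M * h x" if "1 + sqn x < s0" for x
  proof -
    have "l1 x \<le> m" using l1_le_sqn[of x] that m by linarith
    then have "\<epsilon> ^ m \<le> h x" unfolding h_def using \<epsilon> by (intro power_decreasing) auto
    then show ?thesis using \<epsilon> by (simp add: M_def field_simps)
  qed
  define g where "g x = decay p x + M * h x" for x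
  have avg_g: "avg g x = avg (decay p) x + M * avg h x" for x
    unfolding g_def by (simp add: avg_add avg_cmult)
  \<comment> \<open>The three bounds serve the far part of \<open>decay\<close>, the far part of \<open>h\<close>, and the sites near the origin.\<close>
  define \<delta> where "\<delta> = min (\<kappa> / (2 * 9 powr p)) (min (\<epsilon>\<^sup>2 / (2 * M)) (1 / (1 + M)\<^sup>2))"
  have \<delta>: "0 < \<delta>" using \<kappa> \<epsilon> M by (simp add: \<delta>_def)
  have "g x + \<delta> * (avg g x)\<^sup>2 \<le> avg g x" if x: "x \<noteq> 0" for x
  proof (cases "s0 \<le> 1 + sqn x")
    case True
    let ?a = "avg (decay p) x" and ?b = "M * avg h x"
    have nn: "0 \<le> ?a" "0 \<le> ?b" using M h decay_pos by (auto intro!: avg_nonneg mult_nonneg_nonneg simp: less_imp_le[of 0 M] less_imp_le[OF h(1)] less_imp_le[OF decay_pos])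
    have "(?a + ?b)\<^sup>2 \<le> 2 * ?a\<^sup>2 + 2 * ?b\<^sup>2"
      using zero_le_power2[of "?a - ?b"] by (simp add: power2_sum power2_diff)
    then have "\<delta> * (?a + ?b)\<^sup>2 \<le> \<delta> * (2 * ?a\<^sup>2 + 2 * ?b\<^sup>2)" using \<delta> by (intro mult_left_mono) auto
    also have "\<dots> = \<delta> * (2 * ?a\<^sup>2) + \<delta> * (2 * ?b\<^sup>2)" by (simp add: algebra_simps)
    also have "\<delta> * (2 * ?a\<^sup>2) \<le> \<kappa> * (decay p x / (1 + sqn x))"
    proof -
      have "?a\<^sup>2 \<le> (3 powr p * decay p x)\<^sup>2" using nn avg_decay_le[of p x] p by (intro power_mono) auto
      also have "\<dots> = 9 powr p * (decay p x)\<^sup>2"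
      proof -
        have "(3 powr p)\<^sup>2 = (9::real) powr p" by (simp add: power2_eq_square flip: powr_mult)
        then show ?thesis by (simp add: power_mult_distrib)
      qed
      also have "(decay p x)\<^sup>2 \<le> decay p x / (1 + sqn x)"
      proof -
        have "decay p x \<le> (1 + sqn x) powr (-1)"
          unfolding decay_def using p sqn_nonneg[of x] by (intro powr_mono) auto
        then have "decay p x * decay p x \<le> decay p x * (1 + sqn x) powr (-1)"
          using decay_pos[of p x] by (intro mult_left_mono) auto
        then show ?thesis using sqn_nonneg[of x] by (simp add: power2_eq_square powr_minus divide_inverse)
      qed
      finally have "2 * ?a\<^sup>2 \<le> 2 * 9 powr p * (decay p x / (1 + sqn x))" by simp
      then have "\<delta> * (2 * ?a\<^sup>2) \<le> \<kappa> / (2 * 9 powr p) * (2 * 9 powr p * (decay p x / (1 + sqn x)))"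
        by (rule mult_mono[rotated]) (use \<kappa> in \<open>auto simp: \<delta>_def\<close>)
      then show ?thesis by simp
    qed
    also have "\<delta> * (2 * ?b\<^sup>2) \<le> M * h x"
    proof -
      have "(avg h x)\<^sup>2 \<le> (h x / \<epsilon>)\<^sup>2" using h by (intro power_mono avg_nonneg) (auto simp: less_imp_le)
      also have "\<dots> \<le> h x / \<epsilon>\<^sup>2"
        using h[of x] \<epsilon> by (simp add: power_divide divide_right_mono power2_eq_square mult_left_le)
      finally have "2 * M\<^sup>2 * (avg h x)\<^sup>2 \<le> 2 * M\<^sup>2 * (h x / \<epsilon>\<^sup>2)"
        by (rule mult_left_mono) simp
      then have "2 * ?b\<^sup>2 \<le> 2 * M\<^sup>2 * (h x / \<epsilon>\<^sup>2)"
        by (simp only: power_mult_distrib mult.assoc)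
      then have "\<delta> * (2 * ?b\<^sup>2) \<le> \<epsilon>\<^sup>2 / (2 * M) * (2 * M\<^sup>2 * (h x / \<epsilon>\<^sup>2))"
        by (rule mult_mono[rotated]) (use M in \<open>auto simp: \<delta>_def\<close>)
      also have "\<dots> = M * h x" using M \<epsilon> by (simp add: field_simps power2_eq_square)
      finally show ?thesis .
    qed
    finally have "\<delta> * (avg g x)\<^sup>2 \<le> \<kappa> * (decay p x / (1 + sqn x)) + M * h x" by (simp add: avg_g)
    moreover have "M * (2 * h x) \<le> ?b" using h2[OF x] M by (intro mult_left_mono) auto
    ultimately show ?thesis using far[OF True] by (simp add: avg_g g_def)
  next
    case False
    have "avg g x \<le> 1 + M"
    proof (rule avg_le)
      fix e :: "'d site"
      have "M * h (x + e) \<le> M * 1" using h(2) M by (intro mult_left_mono) auto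
      then show "g (x + e) \<le> 1 + M" using decay_le_1[of p "x + e"] p by (simp add: g_def)
    qed
    moreover have "0 \<le> avg g x" using h M decay_pos
      by (auto intro!: avg_nonneg add_nonneg_nonneg mult_nonneg_nonneg simp: g_def less_imp_le[of 0 M] less_imp_le[OF h(1)] less_imp_le[OF decay_pos])
    ultimately have "(avg g x)\<^sup>2 \<le> (1 + M)\<^sup>2" by (intro power_mono)
    then have "\<delta> * (avg g x)\<^sup>2 \<le> 1 / (1 + M)\<^sup>2 * (1 + M)\<^sup>2"
      using M by (intro mult_mono) (auto simp: \<delta>_def)
    then have "\<delta> * (avg g x)\<^sup>2 \<le> 1" using M by simp
    moreover have "M * (2 * h x) \<le> M * avg h x" using h2[OF x] M by (intro mult_left_mono) auto
    moreover have "0 \<le> avg (decay p) x" using decay_pos by (intro avg_nonneg) (auto simp: less_imp_le[OF decay_pos])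
    moreover have "2 \<le> M * h x" using near False by auto
    ultimately show ?thesis using decay_le_1[of p x] p by (simp add: avg_g g_def)
  qed
  moreover obtain C where C: "0 < C" "\<And>x. h x \<le> C * decay p x"
    using l1_power_le_decay[where 'd = 'd, OF \<epsilon>(1,2) p0] unfolding h_def by blast
  moreover have "g x \<le> (1 + M * C) * decay p x" for x
    using mult_left_mono[OF C(2)[of x], of M] M by (simp add: g_def algebra_simps)
  moreover have "decay p x \<le> g x" for x using M h[of x] by (simp add: g_def)
  ultimately show ?thesis using that[of \<delta> "1 + M * C" g] \<delta> M by simp
qed

section \<open>Sums and cardinalities over cubes and balls\<close>

text \<open>
  Cubes rather than balls carry the sums below, as a sum of products over a cube factorizes.
\<close>

definition cube :: "nat \<Rightarrow> ('d::finite) site set" where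
  "cube R = {x. \<forall>i. x $ i \<in> {- int R..int R}}"

lemma bij_betw_cube: "bij_betw vec_nth (cube R :: 'd::finite site set) (PiE UNIV (\<lambda>_. {- int R..int R}))"
  by (rule bij_betwI[where g = vec_lambda]) (auto simp: cube_def)

lemma finite_cube [simp]: "finite (cube R :: 'd::finite site set)"
  using bij_betw_finite[OF bij_betw_cube[where 'd = 'd, of R]] finite_PiE[of UNIV "\<lambda>_ :: 'd. {- int R..int R}"]
  by simp

lemma sum_cube_prod:
  fixes f :: "int \<Rightarrow> real"
  shows "(\<Sum>x\<in>(cube R :: 'd::finite site set). \<Prod>i\<in>UNIV. f (x $ i)) = (\<Sum>m=- int R..int R. f m) ^ CARD('d)"
proof -
  have "(\<Sum>x\<in>(cube R :: 'd site set). \<Prod>i\<in>UNIV. f (x $ i))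
      = (\<Sum>v\<in>PiE (UNIV :: 'd set) (\<lambda>_. {- int R..int R}). \<Prod>i\<in>UNIV. f (v i))"
    by (rule sum.reindex_bij_betw[OF bij_betw_cube])
  also have "\<dots> = (\<Prod>i\<in>(UNIV :: 'd set). \<Sum>m=- int R..int R. f m)"
    by (rule prod_sum_PiE[symmetric]) auto
  finally show ?thesis by simp
qed

lemma card_cube: "card (cube R :: 'd::finite site set) = (2 * R + 1) ^ CARD('d)"
proof -
  have "real (card (cube R :: 'd site set)) = real ((2 * R + 1) ^ CARD('d))"
    using sum_cube_prod[where 'd = 'd, of "\<lambda>_. 1" R] by (simp add: add.commute)
  then show ?thesis by (simp only: of_nat_eq_iff)
qed

text \<open>
  The summand is at most the increment of \<open>k powr a / a\<close>, by concavity in the form of Young's inequality.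
\<close>

lemma sum_powr_le:
  assumes "0 < a" "a \<le> 1"
  shows "(\<Sum>m=1..k. real m powr (a - 1)) \<le> real k powr a / a"
proof (induction k)
  case (Suc k)
  let ?m = "real (Suc k)"
  have "real k powr a \<le> ?m powr a * (1 - a / ?m)"
  proof (cases "k = 0")
    case True
    then show ?thesis using assms by simp
  next
    case False
    have "(real k / ?m) powr a * 1 powr (1 - a) \<le> a * (real k / ?m) + (1 - a) * 1"
      using assms False by (intro Youngs_inequality_0) auto
    also have "\<dots> = 1 - a / ?m" by (simp add: field_simps)
    finally have "?m powr a * (real k / ?m) powr a \<le> ?m powr a * (1 - a / ?m)"
      by (intro mult_left_mono) auto
    also have "?m powr a * (real k / ?m) powr a = real k powr a"
      by (simp flip: powr_mult)
    finally show ?thesis .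
  qed
  then have "real k powr a / a + ?m powr (a - 1) \<le> ?m powr a * (1 - a / ?m) / a + ?m powr (a - 1)"
    using assms by (simp add: divide_right_mono)
  also have "\<dots> = ?m powr a / a"
  proof -
    have "X * (1 - a / m) / a + X / m = X / a" if "0 < m" for X m :: real
      using that assms by (simp add: right_diff_distrib diff_divide_distrib)
    then show ?thesis by (simp add: powr_diff)
  qed
  finally show ?case using Suc by simp
qed simp

lemma sum_symmetric_powr_le:
  assumes "0 < a" "a \<le> 1"
  shows "(\<Sum>m=- int R..int R. (1 + (real_of_int m)\<^sup>2) powr (- ((1 - a) / 2))) \<le> 4 / a * (real R + 1) powr a"
proof -
  let ?f = "\<lambda>m. (1 + (real_of_int m)\<^sup>2) powr (- ((1 - a) / 2))"
  have b: "?f m \<le> 2 * real (nat \<bar>m\<bar> + 1) powr (a - 1)" for m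
  proof -
    define y where "y = real_of_int \<bar>m\<bar>"
    have y: "0 \<le> y" "real (nat \<bar>m\<bar> + 1) = 1 + y" "(real_of_int m)\<^sup>2 = y\<^sup>2" by (auto simp: y_def)
    have "(1 + y)\<^sup>2 / 2 \<le> 1 + y\<^sup>2"
      using zero_le_power2[of "1 - y"] by (simp add: power2_eq_square algebra_simps)
    moreover have "0 < (1 + y)\<^sup>2 / 2" using y by (simp add: add_nonneg_eq_0_iff)
    ultimately have "(1 + y\<^sup>2) powr (- ((1 - a) / 2)) \<le> ((1 + y)\<^sup>2 / 2) powr (- ((1 - a) / 2))"
      using assms by (intro powr_mono2') auto
    also have "\<dots> = ((1 + y)\<^sup>2) powr (- ((1 - a) / 2)) * 2 powr ((1 - a) / 2)"
      using y by (simp add: powr_divide powr_minus field_simps)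
    also have "((1 + y)\<^sup>2) powr (- ((1 - a) / 2)) = (1 + y) powr (a - 1)"
    proof -
      have "(1 + y)\<^sup>2 = (1 + y) powr 2" using y by simp
      moreover have "2 * (- ((1 - a) / 2)) = a - 1" by (simp add: field_simps)
      ultimately show ?thesis by (simp only: powr_powr)
    qed
    also have "(1 + y) powr (a - 1) * 2 powr ((1 - a) / 2) \<le> (1 + y) powr (a - 1) * 2 powr 1"
      using assms by (intro mult_left_mono powr_mono) auto
    finally have "(1 + y\<^sup>2) powr (- ((1 - a) / 2)) \<le> 2 * (1 + y) powr (a - 1)" by simp
    then show ?thesis by (simp only: y(2,3))
  qed
  have "(\<Sum>m=- int R..int R. ?f m) \<le> (\<Sum>m\<in>(int ` {0..R}) \<union> ((\<lambda>k. - int k) ` {0..R}). 2 * real (nat \<bar>m\<bar> + 1) powr (a - 1))"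
  proof (rule order_trans[OF sum_mono[OF b]], rule sum_mono2)
    show "{- int R..int R} \<subseteq> (int ` {0..R}) \<union> ((\<lambda>k. - int k) ` {0..R})"
    proof
      fix m assume m: "m \<in> {- int R..int R}"
      show "m \<in> (int ` {0..R}) \<union> ((\<lambda>k. - int k) ` {0..R})"
      proof (cases "0 \<le> m")
        case True
        then have "m = int (nat m)" "nat m \<in> {0..R}" using m by auto
        then show ?thesis by blast
      next
        case False
        then have "m = - int (nat (- m))" "nat (- m) \<in> {0..R}" using m by auto
        then show ?thesis by blast
      qed
    qed
  qed auto
  also have "\<dots> \<le> (\<Sum>m\<in>int ` {0..R}. 2 * real (nat \<bar>m\<bar> + 1) powr (a - 1))
      + (\<Sum>m\<in>(\<lambda>k. - int k) ` {0..R}. 2 * real (nat \<bar>m\<bar> + 1) powr (a - 1))"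
  proof -
    have "sum f (A \<union> B) \<le> sum f A + sum f B"
      if "finite A" "finite B" "\<And>x. 0 \<le> f x" for A B and f :: "int \<Rightarrow> real"
      using that sum_nonneg[of "A \<inter> B" f] by (simp add: sum_Un)
    then show ?thesis by simp
  qed
  also have "\<dots> = 4 * (\<Sum>k=0..R. real (k + 1) powr (a - 1))"
    by (simp add: sum.reindex inj_on_def sum_distrib_left[symmetric])
  also have "(\<Sum>k=0..R. real (k + 1) powr (a - 1)) = (\<Sum>k=1..R + 1. real k powr (a - 1))"
    using sum.shift_bounds_cl_nat_ivl[of "\<lambda>k. real k powr (a - 1)" 0 1 R] by simp
  also have "\<dots> \<le> real (R + 1) powr a / a" by (rule sum_powr_le[OF assms])
  finally show ?thesis by (simp add: add.commute)
qed

text \<open>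
  With \<open>2 * p = d - 1\<close> the sum is of order \<open>R\<close>. Bounding \<open>1 + sqn x\<close> below by \<open>1 + (x $ i)\<^sup>2\<close> in a \<open>d\<close>-th
  part of the exponent for each \<open>i\<close> turns the summand into a product over the coordinates; each of the \<open>d\<close> factors
  sums to the order of \<open>R powr (1 / d)\<close>.
\<close>

lemma sum_cube_decay_le:
  assumes "p = (real CARD('d::finite) - 1) / 2"
  shows "(\<Sum>x\<in>(cube R :: 'd::finite site set). decay p x) \<le> (4 * real CARD('d)) ^ CARD('d) * (real R + 1)"
proof -
  let ?d = "real CARD('d)"
  have d: "1 \<le> ?d" using zero_less_card_finite[where 'a = 'd] by linarith
  let ?q = "(1 - 1 / ?d) / 2"
  have pq: "p = ?q * ?d" using d by (simp add: assms field_simps)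
  have "decay p x \<le> (\<Prod>i\<in>UNIV. (1 + (real_of_int (x $ i))\<^sup>2) powr (- ?q))" for x :: "'d site"
  proof -
    have "decay p x = (\<Prod>i\<in>(UNIV :: 'd set). (1 + sqn x) powr (- ?q))"
      using sqn_nonneg[of x] by (simp add: decay_def pq powr_power add_nonneg_eq_0_iff mult.commute)
    also have "\<dots> \<le> (\<Prod>i\<in>UNIV. (1 + (real_of_int (x $ i))\<^sup>2) powr (- ?q))"
      using d component_le_sqn[of x]
      by (intro prod_mono conjI powr_mono2') (auto simp: add_pos_nonneg field_simps)
    finally show ?thesis .
  qed
  then have "(\<Sum>x\<in>(cube R :: 'd site set). decay p x)
      \<le> (\<Sum>x\<in>(cube R :: 'd site set). \<Prod>i\<in>UNIV. (1 + (real_of_int (x $ i))\<^sup>2) powr (- ?q))"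
    by (rule sum_mono)
  also have "\<dots> = (\<Sum>m=- int R..int R. (1 + (real_of_int m)\<^sup>2) powr (- ?q)) ^ CARD('d)"
    by (rule sum_cube_prod)
  also have "\<dots> \<le> (4 / (1 / ?d) * (real R + 1) powr (1 / ?d)) ^ CARD('d)"
    using d by (intro power_mono sum_symmetric_powr_le sum_nonneg) auto
  also have "\<dots> = (4 * ?d) ^ CARD('d) * (real R + 1)"
    by (simp add: power_mult_distrib powr_power)
  finally show ?thesis .
qed

lemma lattice_ball_subset_cube: "lattice_ball (real n) \<subseteq> (cube n :: 'd::finite site set)"
proof (cases "n = 0")
  case True
  then show ?thesis by (auto simp: lattice_ball_def)
next
  case False
  show ?thesis
  proof
    fix x :: "'d site" assume "x \<in> lattice_ball (real n)"
    then have "sqn x < (real n)\<^sup>2" using False by (simp add: lattice_ball_iff)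
    then have "(real_of_int (x $ i))\<^sup>2 < (real n)\<^sup>2" for i using component_le_sqn[of x i] by linarith
    then have abs: "\<bar>real_of_int (x $ i)\<bar> < real n" for i
      using power2_less_imp_less[of "\<bar>real_of_int (x $ i)\<bar>" "real n"] by simp
    have "x $ i \<in> {- int n..int n}" for i
      using abs[of i] by (simp add: abs_less_iff; linarith)
    then show "x \<in> cube n" by (simp add: cube_def)
  qed
qed

lemma finite_lattice_ball [simp]: "finite (lattice_ball (real n) :: 'd::finite site set)"
  using finite_subset[OF lattice_ball_subset_cube finite_cube] .

lemma card_lattice_ball_le:
  assumes "1 \<le> n"
  shows "real (card (lattice_ball (real n) :: 'd::finite site set)) \<le> (3 * real n) ^ CARD('d)"
proof -
  have "card (lattice_ball (real n) :: 'd site set) \<le> (2 * n + 1) ^ CARD('d)"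
    using card_mono[OF finite_cube lattice_ball_subset_cube[where 'd = 'd]] by (simp add: card_cube)
  also have "\<dots> \<le> (3 * n) ^ CARD('d)" using assms by (intro power_mono) auto
  finally have "real (card (lattice_ball (real n) :: 'd site set)) \<le> real ((3 * n) ^ CARD('d))"
    by (simp only: of_nat_le_iff)
  then show ?thesis by simp
qed

lemma card_lattice_ball_ge:
  assumes "1 \<le> n"
  shows "(real n / (real CARD('d) + 1)) ^ CARD('d) \<le> real (card (lattice_ball (real n) :: 'd::finite site set))"
proof -
  let ?d = "CARD('d)"
  define m where "m = n div (?d + 1)"
  have sub: "(cube m :: 'd site set) \<subseteq> lattice_ball (real n)"
  proof
    fix x :: "'d site" assume x: "x \<in> cube m"
    have "(real_of_int (x $ i))\<^sup>2 \<le> (real m)\<^sup>2" for i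
    proof -
      have "\<bar>x $ i\<bar> \<le> int m" using x by (simp add: cube_def abs_le_iff minus_le_iff)
      then have "\<bar>real_of_int (x $ i)\<bar> \<le> \<bar>real m\<bar>" by linarith
      then show ?thesis by (simp only: abs_le_square_iff)
    qed
    then have "sqn x \<le> (\<Sum>i\<in>(UNIV :: 'd set). (real m)\<^sup>2)" unfolding sqn_def by (intro sum_mono)
    then have le: "sqn x \<le> real ?d * (real m)\<^sup>2" by simp
    have "real ?d * (real m)\<^sup>2 < (real n)\<^sup>2"
    proof (cases "m = 0")
      case True
      then show ?thesis using assms by simp
    next
      case False
      have "m * (?d + 1) \<le> n" unfolding m_def by (rule div_times_less_eq_dividend)
      then have "(m * (?d + 1))\<^sup>2 \<le> n\<^sup>2" by (rule power_mono) simp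
      moreover have "?d * m\<^sup>2 < (m * (?d + 1))\<^sup>2"
      proof -
        have "?d < (?d + 1)\<^sup>2" by (simp add: power2_eq_square)
        then have "?d * m\<^sup>2 < (?d + 1)\<^sup>2 * m\<^sup>2" using False by (intro mult_strict_right_mono) auto
        then show ?thesis by (simp only: power_mult_distrib mult.commute)
      qed
      ultimately have "?d * m\<^sup>2 < n\<^sup>2" by linarith
      then have "real (?d * m\<^sup>2) < real (n\<^sup>2)" by (simp only: of_nat_less_iff)
      then show ?thesis by simp
    qed
    with le show "x \<in> lattice_ball (real n)" using assms by (simp add: lattice_ball_iff)
  qed
  have "n < (m + 1) * (?d + 1)"
    using dividend_less_div_times[of "?d + 1" n] by (simp add: m_def algebra_simps)
  then have "real n < real ((m + 1) * (?d + 1))" by (simp only: of_nat_less_iff)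
  then have "real n / (real ?d + 1) \<le> real m + 1"
    by (simp add: divide_le_eq algebra_simps)
  also have "\<dots> \<le> real (2 * m + 1)" by simp
  finally have "(real n / (real ?d + 1)) ^ ?d \<le> real (2 * m + 1) ^ ?d" by (intro power_mono) auto
  also have "\<dots> = real (card (cube m :: 'd site set))" by (simp add: card_cube)
  also have "\<dots> \<le> real (card (lattice_ball (real n) :: 'd site set))"
    using card_mono[OF finite_lattice_ball sub] by simp
  finally show ?thesis .
qed

section \<open>The lower bound on the probability of an unfilled ball\<close>

lemma avg_mono_neighbours:
  fixes x :: "'d::finite site"
  assumes "\<And>e. e \<in> unit_vectors \<Longrightarrow> u (x + e) \<le> v (x + e)"
  shows "avg u x \<le> avg v x"
  unfolding avg_def by (intro divide_right_mono sum_mono assms) auto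

lemma sqn_unit_vector:
  fixes e :: "'d::finite site"
  assumes "e \<in> unit_vectors"
  shows "sqn e = 1"
proof -
  obtain j s where "e = axis j s" "s = 1 \<or> s = -1" using assms by (auto simp: unit_vectors_def)
  then show ?thesis using sqn_add_axis[of 0 j s] by (auto simp: sqn_def)
qed

lemma exp_minus_double_le:
  assumes "0 \<le> y" "y \<le> (1/2 :: real)"
  shows "exp (- (2 * y)) \<le> 1 - y"
proof -
  have "2 * y\<^sup>2 \<le> y"
    using mult_left_mono[OF assms(2,1)] by (simp add: power2_eq_square)
  then have "- (2 * y) \<le> ln (1 - y)"
    using ln_one_minus_pos_lower_bound[OF assms] by linarith
  then have "exp (- (2 * y)) \<le> exp (ln (1 - y))" by simp
  then show ?thesis using assms by simp
qed

text \<open>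
  Where \<open>u\<close> exceeds \<open>p0 = pmf \<nu> 0\<close> it is \<open>1 - A / sqn (x - z)\<close>. For large \<open>A\<close> the quadratic term \<open>\<kappa> * A\<^sup>2 / s\<^sup>2\<close> of the
  generating function beats the error \<open>4 * A / s\<^sup>2\<close> of \<open>avg_inverse_sqn_le\<close>. The lower cutoff by \<open>p0\<close> is harmless
  since \<open>p0 \<le> pgf \<nu> s\<close> for all \<open>s\<close>; it keeps \<open>u\<close> positive off \<open>z\<close>, which matters for the sites near \<open>z\<close>
  when \<open>n\<close> is small.
\<close>

lemma supersolution_exists:
  assumes "offspring_law \<nu>"
  shows "\<exists>A>0. \<forall>z :: 'd::finite site. \<exists>u. (\<forall>x. 0 \<le> u x \<and> u x \<le> 1 \<and> u x \<le> pgf \<nu> (avg u x)) \<and> u z = 0 \<and>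
    (\<forall>x. x \<noteq> z \<longrightarrow> exp (- (A / sqn (x - z))) \<le> u x)"
proof -
  obtain \<kappa> where \<kappa>: "0 < \<kappa>" "\<kappa> \<le> 1/4"
    "\<And>s. 0 \<le> s \<Longrightarrow> s \<le> 1 \<Longrightarrow> 1 - s + \<kappa> * s\<^sup>2 \<le> pgf \<nu> (1 - s)"
    using pgf_lower_bound[OF assms] by metis
  define p0 where "p0 = pmf \<nu> 0"
  have p0: "0 < p0" "p0 \<le> 1"
    using offspring_law_nontrivial(1)[OF assms] by (simp_all add: p0_def pmf_le_1)
  \<comment> \<open>The 7 makes \<open>avg_inverse_sqn_le\<close> applicable wherever \<open>A < sqn (x - z)\<close>.\<close>
  define A where "A = max 7 (4 / \<kappa>)"
  have A: "7 \<le> A" "4 \<le> \<kappa> * A"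
    using \<kappa> mult_left_mono[of "4 / \<kappa>" A \<kappa>] by (simp_all add: A_def)
  define A' where "A' = 2 * A * (1 - ln p0)"
  have ln: "ln p0 \<le> 0" using p0 by simp
  have A': "0 < A'" using A ln by (simp add: A'_def)
  have "\<exists>u. (\<forall>x. 0 \<le> u x \<and> u x \<le> 1 \<and> u x \<le> pgf \<nu> (avg u x)) \<and> u z = 0 \<and>
    (\<forall>x. x \<noteq> z \<longrightarrow> exp (- (A' / sqn (x - z))) \<le> u x)" for z :: "'d site"
  proof -
    define u where "u x = (if x = z then 0 else max p0 (1 - A / sqn (x - z)))" for x
    have u01: "0 \<le> u x" "u x \<le> 1" for x using p0 A by (auto simp: u_def)
    have avg01: "0 \<le> avg u x" "avg u x \<le> 1" for x using u01 by (auto intro: avg_nonneg avg_le_1)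
    have "u x \<le> pgf \<nu> (avg u x)" for x
    proof (cases "x = z")
      case True
      then show ?thesis using pgf_nonneg[OF avg01] by (simp add: u_def)
    next
      case False
      have p0_le: "p0 \<le> pgf \<nu> (avg u x)" unfolding p0_def by (rule pmf_0_le_pgf[OF avg01])
      define s where "s = sqn (x - z)"
      have far: "1 - A / s \<le> pgf \<nu> (avg u x)" if small: "p0 < 1 - A / s"
      proof -
        have s0: "0 < s" using one_le_sqn[of "x - z"] False by (simp add: s_def)
        have "A / s < 1" using small p0 by linarith
        then have As: "A < s" using s0 by simp
        then have s7: "7 \<le> s" using A by linarith
        define q where "q = A / s + 4 * A / s\<^sup>2"
        define t where "t = 1 - avg u x"
        have t: "0 \<le> t" "t \<le> 1" "avg u x = 1 - t" using avg01[of x] by (auto simp: t_def)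
        have "1 - A * avg (\<lambda>y. 1 / sqn y) (x - z) = avg (\<lambda>y. 1 - A * (1 / sqn (y - z))) x"
          unfolding avg_diff avg_const avg_cmult avg_shift[of "\<lambda>y. 1 / sqn y"] ..
        also have "\<dots> \<le> avg u x"
        proof (rule avg_mono_neighbours)
          fix e :: "'d site" assume e: "e \<in> unit_vectors"
          have "x + e \<noteq> z"
          proof
            assume "x + e = z"
            then have "x - z = - e" by (metis add_diff_cancel_left' minus_diff_eq)
            then have "s = 1" using sqn_unit_vector[OF e] by (simp add: s_def)
            then show False using s7 by simp
          qed
          then show "1 - A * (1 / sqn (x + e - z)) \<le> u (x + e)" by (simp add: u_def)
        qed
        finally have "t \<le> A * avg (\<lambda>y. 1 / sqn y) (x - z)" by (simp add: t_def)
        also have "\<dots> \<le> A * (1 / s + 4 / s\<^sup>2)"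
          unfolding s_def using A s7 by (intro mult_left_mono avg_inverse_sqn_le) (auto simp: s_def)
        finally have tq: "t \<le> q" by (simp add: q_def algebra_simps)
        have q2: "q \<le> 2"
        proof -
          have "A / s \<le> 1" "A / s * (4 / s) \<le> 1 * 1"
            using As s7 A by (auto intro!: mult_mono)
          moreover have "q = A / s + A / s * (4 / s)" by (simp add: q_def power2_eq_square)
          ultimately show ?thesis by linarith
        qed
        have "\<kappa> * (q + t) \<le> 1/4 * 4" using \<kappa> q2 t tq by (intro mult_mono) auto
        then have "(q - t) * (\<kappa> * (q + t)) \<le> (q - t) * 1" using tq by (intro mult_left_mono) auto
        then have "t - \<kappa> * t\<^sup>2 \<le> q - \<kappa> * q\<^sup>2" by (simp add: power2_eq_square algebra_simps)
        also have "\<dots> \<le> A / s"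
        proof -
          have "4 * (A / s\<^sup>2) \<le> \<kappa> * A * (A / s\<^sup>2)" using A by (intro mult_right_mono) auto
          also have "\<dots> = \<kappa> * (A / s)\<^sup>2" by (simp add: power2_eq_square)
          also have "\<dots> \<le> \<kappa> * q\<^sup>2" using \<kappa> A s0 by (intro mult_left_mono power_mono) (auto simp: q_def)
          finally show ?thesis by (simp add: q_def)
        qed
        finally show ?thesis using \<kappa>(3)[OF t(1,2)] t(3) by simp
      qed
      have "max p0 (1 - A / s) \<le> pgf \<nu> (avg u x)"
        using p0_le far by (cases "p0 < 1 - A / s") simp_all
      then show ?thesis using False by (simp add: u_def s_def)
    qed
    moreover have "exp (- (A' / sqn (x - z))) \<le> u x" if xz: "x \<noteq> z" for x
    proof -
      define s where "s = sqn (x - z)"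
      have s: "1 \<le> s" using one_le_sqn[of "x - z"] xz by (simp add: s_def)
      show ?thesis
      proof (cases "2 * A \<le> s")
        case True
        have y: "0 \<le> A / s" "A / s \<le> 1/2" using True A s by (auto simp: field_simps)
        have "2 * A * 1 \<le> A'" unfolding A'_def using A ln by (intro mult_left_mono) auto
        then have "2 * (A / s) \<le> A' / s" using s by (simp add: divide_right_mono)
        then have "exp (- (A' / s)) \<le> exp (- (2 * (A / s)))" by simp
        also have "\<dots> \<le> 1 - A / s" by (rule exp_minus_double_le[OF y])
        finally show ?thesis using xz by (simp add: u_def s_def)
      next
        case False
        have "- ln p0 \<le> A' / s"
        proof -
          have "- ln p0 * s \<le> - ln p0 * (2 * A)" using False ln by (intro mult_left_mono) auto
          also have "\<dots> \<le> A'" using A by (simp add: A'_def algebra_simps)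
          finally show ?thesis using s by (simp add: field_simps)
        qed
        then have "exp (- (A' / s)) \<le> exp (ln p0)" by simp
        then show ?thesis using xz p0 by (simp add: u_def s_def)
      qed
    qed
    ultimately show ?thesis using u01 by (intro exI[of _ u]) (auto simp: u_def)
  qed
  then show ?thesis using A' by blast
qed

text \<open>
  A site \<open>z\<close> of the ball on a coordinate axis next to the boundary; its distance to every possible
  starting point is of order \<open>n\<close>, even for \<open>n = 2\<close> and \<open>n = 3\<close>.
\<close>

lemma sqn_far_site:
  fixes x :: "'d::finite site"
  assumes "2 \<le> n" "x \<in> lattice_ball (real n / 2)" and z: "z = axis j (int n - 1)"
  shows "x \<noteq> z" "(real n / 4)\<^sup>2 \<le> sqn (x - z)"
proof -
  have sz: "sqn z = (real n - 1)\<^sup>2"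
    using sqn_add_axis[of 0 j "int n - 1"] by (simp add: z sqn_def)
  then have rz: "sqrt (sqn z) = real n - 1" using assms by simp
  have rx: "sqrt (sqn x) < real n / 2" using assms by (simp add: lattice_ball_iff_sqrt)
  then show ne: "x \<noteq> z" using rz assms by auto
  have "sqrt (sqn (- (x - z) + x)) \<le> sqrt (sqn (- (x - z))) + sqrt (sqn x)" by (rule sqn_triangle)
  then have "real n - 1 - real n / 2 \<le> sqrt (sqn (x - z))"
    using rz rx by (simp only: sqn_minus) simp
  moreover have "1 \<le> sqrt (sqn (x - z))" using one_le_sqn[of "x - z"] ne by simp
  moreover have "4 \<le> real n \<or> real n \<le> 4" by linarith
  ultimately have "real n / 4 \<le> sqrt (sqn (x - z))" by linarith
  then have "(real n / 4)\<^sup>2 \<le> (sqrt (sqn (x - z)))\<^sup>2" by (rule power_mono) simp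
  then show "(real n / 4)\<^sup>2 \<le> sqn (x - z)" by simp
qed

lemma weight_mono:
  assumes "\<And>x. 0 < \<eta> x \<Longrightarrow> 0 \<le> u x \<and> u x \<le> v x"
  shows "weight u \<eta> \<le> weight v \<eta>"
  unfolding weight_def using assms by (intro prod_mono) (auto intro: power_mono)

lemma finite_config_in_ball:
  fixes \<eta> :: "'d::finite config"
  assumes "{z. \<eta> z > 0} \<subseteq> lattice_ball (real n / 2)"
  shows "finite_config \<eta>"
proof -
  have "lattice_ball (real n / 2) \<subseteq> (lattice_ball (real n) :: 'd site set)"
    by (auto simp: lattice_ball_def)
  then show ?thesis unfolding finite_config_def
    using assms finite_lattice_ball by (meson finite_subset order_trans)
qed

text \<open>
  Each of the at most \<open>\<alpha> * (3 * n) ^ d\<close> particles contributes a factor of at least \<open>exp (- const / n\<^sup>2)\<close> to the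
  initial weight, where \<open>z\<close> is chosen near the boundary.
\<close>

lemma prob_not_filled_lower:
  assumes "offspring_law \<nu>" "2 \<le> CARD('d::finite)"
  shows "\<exists>c>0. \<forall>\<alpha> n. \<forall>\<eta> :: 'd config. \<forall>r. 0 < \<alpha> \<longrightarrow> 1 \<le> n \<longrightarrow> (n = 1 \<longrightarrow> \<eta> = (\<lambda>_. 0)) \<longrightarrow> linear_order r \<longrightarrow>
    {z. \<eta> z > 0} \<subseteq> lattice_ball (real n / 2) \<longrightarrow>
    real (num_particles \<eta>) \<le> \<alpha> * real (card (lattice_ball (real n) :: 'd site set)) \<longrightarrow>
    exp (- (c * \<alpha> * real n ^ (CARD('d) - 2))) \<le> prob_not_filled \<nu> r \<eta> n"
proof -
  let ?d = "CARD('d)"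
  obtain A where A: "0 < A" "\<And>z :: 'd site. \<exists>u. (\<forall>x. 0 \<le> u x \<and> u x \<le> 1 \<and> u x \<le> pgf \<nu> (avg u x)) \<and> u z = 0 \<and>
    (\<forall>x. x \<noteq> z \<longrightarrow> exp (- (A / sqn (x - z))) \<le> u x)"
    using supersolution_exists[where 'd = 'd, OF assms(1)] by blast
  \<comment> \<open>From \<open>\<parallel>x - z\<parallel> \<ge> n / 4\<close> and \<open>|\<eta>| \<le> \<alpha> * (3 * n) ^ d\<close>.\<close>
  define c where "c = 16 * A * 3 ^ ?d"
  have "exp (- (c * \<alpha> * real n ^ (?d - 2))) \<le> prob_not_filled \<nu> r \<eta> n"
    if \<alpha>: "0 < \<alpha>" and n: "1 \<le> n" "n = 1 \<longrightarrow> \<eta> = (\<lambda>_. 0)" and r: "linear_order r"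
      and supp: "{z. \<eta> z > 0} \<subseteq> lattice_ball (real n / 2)"
      and num: "real (num_particles \<eta>) \<le> \<alpha> * real (card (lattice_ball (real n) :: 'd site set))"
    for \<alpha> n r and \<eta> :: "'d config"
  proof -
    have c: "0 < c" using A by (simp add: c_def)
    fix j :: 'd
    define z :: "'d site" where "z = axis j (int n - 1)"
    obtain u where u: "\<And>x. 0 \<le> u x" "\<And>x. u x \<le> 1" "\<And>x. u x \<le> pgf \<nu> (avg u x)" "u z = 0"
      "\<And>x. x \<noteq> z \<Longrightarrow> exp (- (A / sqn (x - z))) \<le> u x"
      using A(2)[of z] by blast
    have zB: "z \<in> lattice_ball (real n)"
      using n sqn_add_axis[of 0 j "int n - 1"]
      by (simp add: z_def lattice_ball_iff) (simp add: sqn_def power_strict_mono)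
    have "weight u \<eta> \<le> prob_not_filled \<nu> r \<eta> n"
      by (rule prob_not_filled_ge[OF r finite_config_in_ball[OF supp] u(1,2,4,3) zB])
    moreover have "exp (- (c * \<alpha> * real n ^ (?d - 2))) \<le> weight u \<eta>"
    proof (cases "n = 1")
      case True
      then show ?thesis using n c \<alpha> by (simp add: weight_def)
    next
      case False
      then have n2: "2 \<le> n" using n by simp
      define v where "v = exp (- (16 * A / (real n)\<^sup>2))"
      have "v \<le> u x" if "0 < \<eta> x" for x
      proof -
        have x: "x \<in> lattice_ball (real n / 2)" using supp that by auto
        note far = sqn_far_site[OF n2 x z_def]
        have "A / sqn (x - z) \<le> A / (real n / 4)\<^sup>2"
          using A n2 far by (intro divide_left_mono mult_pos_pos) (auto intro: less_le_trans[of 0 "(real n / 4)\<^sup>2"])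
        also have "\<dots> = 16 * A / (real n)\<^sup>2" by (simp add: power_divide)
        finally have "v \<le> exp (- (A / sqn (x - z)))" by (simp add: v_def)
        then show ?thesis using u(5)[OF far(1)] by linarith
      qed
      then have "weight (\<lambda>_. v) \<eta> \<le> weight u \<eta>" by (intro weight_mono) (auto simp: v_def)
      moreover have "exp (- (c * \<alpha> * real n ^ (?d - 2))) \<le> weight (\<lambda>_. v) \<eta>"
      proof -
        have "real (num_particles \<eta>) \<le> \<alpha> * (3 * real n) ^ ?d"
          using num mult_left_mono[OF card_lattice_ball_le[where 'd = 'd, OF n(1)], of \<alpha>] \<alpha> by linarith
        then have "16 * A / (real n)\<^sup>2 * real (num_particles \<eta>) \<le> 16 * A / (real n)\<^sup>2 * (\<alpha> * (3 * real n) ^ ?d)"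
          using A by (intro mult_left_mono) auto
        also have "(3 * real n) ^ ?d = 3 ^ ?d * (real n ^ (?d - 2) * (real n)\<^sup>2)"
        proof -
          have "real n ^ (?d - 2) * (real n)\<^sup>2 = real n ^ (?d - 2 + 2)" by (rule power_add[symmetric])
          also have "?d - 2 + 2 = ?d" using assms(2) by simp
          finally show ?thesis by (simp add: power_mult_distrib)
        qed
        also have "16 * A / (real n)\<^sup>2 * (\<alpha> * (3 ^ ?d * (real n ^ (?d - 2) * (real n)\<^sup>2))) = c * \<alpha> * real n ^ (?d - 2)"
          using n2 by (simp add: c_def)
        finally have "exp (- (c * \<alpha> * real n ^ (?d - 2))) \<le> exp (- (16 * A / (real n)\<^sup>2 * real (num_particles \<eta>)))"
          by simp
        also have "\<dots> = v ^ num_particles \<eta>"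
          unfolding v_def by (simp add: mult.commute flip: exp_of_nat_mult)
        finally show ?thesis by (simp add: weight_const)
      qed
      ultimately show ?thesis by linarith
    qed
    ultimately show "exp (- (c * \<alpha> * real n ^ (?d - 2))) \<le> prob_not_filled \<nu> r \<eta> n" by linarith
  qed
  moreover have "0 < c" using A by (simp add: c_def)
  ultimately show ?thesis by blast
qed

section \<open>The upper bound on the probability of an unfilled ball\<close>

text \<open>
  The truncation at level \<open>\<tau>\<close> preserves the inequality: where \<open>u = 1\<close> it is trivial, and elsewhere the untruncated
  function is a bound for \<open>u\<close> from above, including at \<open>z\<close>. Multiplication by a small \<open>c\<close> shrinks the
  square \<open>S * (c * avg g)\<^sup>2\<close> relative to the gap of \<open>c * g\<close>.
\<close>

lemma subsolution:
  fixes g :: "'d::finite site \<Rightarrow> real"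
  assumes g: "0 < \<delta>" "1 \<le> C" "\<And>x. x \<noteq> 0 \<Longrightarrow> g x + \<delta> * (avg g x)\<^sup>2 \<le> avg g x"
      "\<And>x. 0 \<le> g x" "\<And>x. g x \<le> C"
    and S: "1 \<le> S" "\<And>s. 0 \<le> s \<Longrightarrow> s \<le> 1 \<Longrightarrow> pgf \<nu> (1 - s) \<le> 1 - s + S * s\<^sup>2"
    and c: "0 < c" "c \<le> 1 / (2 * C)" "c \<le> \<delta> / S" and \<tau>: "0 < \<tau>"
    and u: "\<And>x. u x = (if x = z then 0 else 1 - c * max 0 (g (x - z) - \<tau>))"
  shows "0 \<le> u x" "u x \<le> 1" "x \<noteq> z \<Longrightarrow> pgf \<nu> (avg u x) \<le> u x"
    "x \<noteq> z \<Longrightarrow> exp (- (2 * c * g (x - z))) \<le> u x"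
proof -
  have cC: "c * C \<le> 1/2" using c g by (simp add: field_simps)
  have half: "c * max 0 (g y - \<tau>) \<le> 1/2" "0 \<le> c * max 0 (g y - \<tau>)" for y
  proof -
    have "max 0 (g y - \<tau>) \<le> C" using g(2,5) \<tau> by (smt (verit))
    then have "c * max 0 (g y - \<tau>) \<le> c * C" using c by (intro mult_left_mono) auto
    then show "c * max 0 (g y - \<tau>) \<le> 1/2" using cC by linarith
    show "0 \<le> c * max 0 (g y - \<tau>)" using c by simp
  qed
  have u01: "0 \<le> u x" "u x \<le> 1" for x using half[of "x - z"] by (auto simp: u)
  show "0 \<le> u x" "u x \<le> 1" by (rule u01)+
  have avg01: "0 \<le> avg u x" "avg u x \<le> 1" using u01 by (auto intro: avg_nonneg avg_le_1)
  show "pgf \<nu> (avg u x) \<le> u x" if xz: "x \<noteq> z"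
  proof (cases "g (x - z) \<le> \<tau>")
    case True
    then show ?thesis using xz pgf_le_1[OF avg01] by (simp add: u)
  next
    case False
    define a where "a = avg g (x - z)"
    have a: "g (x - z) + \<delta> * a\<^sup>2 \<le> a" unfolding a_def using xz by (intro g(3)) simp
    then have ag: "g (x - z) \<le> a" using g(1) zero_le_power2[of a] by (smt (verit) mult_nonneg_nonneg)
    have aC: "a \<le> C" unfolding a_def by (intro avg_le g(5))
    define q where "q = c * (a - \<tau>)"
    have "a - \<tau> \<le> C" using aC \<tau> by linarith
    then have "q \<le> c * C" unfolding q_def using c by (intro mult_left_mono) auto
    then have q: "0 \<le> q" "q \<le> 1"
    proof -
      show "0 \<le> q" using c ag False by (simp add: q_def)
      show "q \<le> 1" using \<open>q \<le> c * C\<close> cC by linarith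
    qed
    have "avg u x \<le> avg (\<lambda>y. 1 - c * (g (y - z) - \<tau>)) x"
    proof (rule avg_mono)
      fix y
      have "c * (g (y - z) - \<tau>) \<le> c * max 0 (g (y - z) - \<tau>)" using c by (intro mult_left_mono) auto
      then have "c * (g (y - z) - \<tau>) \<le> 1" and "1 - c * max 0 (g (y - z) - \<tau>) \<le> 1 - c * (g (y - z) - \<tau>)"
        using half[of "y - z"] by linarith+
      then show "u y \<le> 1 - c * (g (y - z) - \<tau>)" unfolding u by (cases "y = z") auto
    qed
    also have "\<dots> = 1 - q"
      unfolding avg_diff avg_const avg_cmult avg_shift[of g] q_def a_def ..
    finally have "pgf \<nu> (avg u x) \<le> pgf \<nu> (1 - q)" using q avg01 by (intro pgf_mono) auto
    also have "\<dots> \<le> 1 - q + S * q\<^sup>2" by (rule S(2)[OF q])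
    also have "S * q\<^sup>2 \<le> c * (a - g (x - z))"
    proof -
      have "q \<le> c * a" unfolding q_def using c \<tau> by (intro mult_left_mono) auto
      then have "q\<^sup>2 \<le> (c * a)\<^sup>2" using q by (intro power_mono) auto
      then have "S * q\<^sup>2 \<le> S * (c * a)\<^sup>2" using S by (intro mult_left_mono) auto
      also have "\<dots> = c * (S * c * a\<^sup>2)" by (simp add: power2_eq_square)
      also have "\<dots> \<le> c * (\<delta> * a\<^sup>2)"
        using c S by (intro mult_left_mono mult_right_mono) (auto simp: field_simps)
      also have "\<dots> \<le> c * (a - g (x - z))" using a c by (intro mult_left_mono) auto
      finally show ?thesis .
    qed
    finally have "pgf \<nu> (avg u x) \<le> 1 - c * (g (x - z) - \<tau>)" by (simp add: q_def algebra_simps)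
    then show ?thesis using False xz by (simp add: u)
  qed
  show "exp (- (2 * c * g (x - z))) \<le> u x" if xz: "x \<noteq> z"
  proof -
    have "max 0 (g (x - z) - \<tau>) \<le> g (x - z)" using g(4)[of "x - z"] \<tau> by simp
    then have "2 * (c * max 0 (g (x - z) - \<tau>)) \<le> 2 * (c * g (x - z))" using c by simp
    then have "exp (- (2 * (c * g (x - z)))) \<le> exp (- (2 * (c * max 0 (g (x - z) - \<tau>))))" by simp
    also have "\<dots> \<le> u x" using exp_minus_double_le[OF half(2,1), of "x - z"] xz by (simp add: u)
    finally show ?thesis by (simp add: mult.assoc)
  qed
qed

text \<open>
  The truncated potential is supported in a cube whose side is proportional to \<open>n\<close>.
\<close>

lemma decay_level_set:
  fixes y :: "'d::finite site"
  assumes "0 < p" "1 \<le> C" "1 \<le> n" "(2 * C) powr (1 / p) * (13 / 4) \<le> (real K)\<^sup>2"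
    and "(1 + 9 / 4 * (real n)\<^sup>2) powr (-p) / 2 < C * decay p y"
  shows "y \<in> cube (K * n)"
proof -
  let ?b = "1 + 9 / 4 * (real n)\<^sup>2"
  have b: "0 < ?b" by (simp add: add_pos_nonneg)
  have s: "0 < 1 + sqn y" using sqn_nonneg[of y] by linarith
  have "?b powr (-p) < 2 * C * (1 + sqn y) powr (-p)" using assms(5) by (simp add: decay_def)
  then have "(1 + sqn y) powr p < 2 * C * ?b powr p"
    using b s by (simp add: powr_minus field_simps)
  then have "((1 + sqn y) powr p) powr (1 / p) < (2 * C * ?b powr p) powr (1 / p)"
    using assms(1) by (intro powr_less_mono2) auto
  also have "(2 * C * ?b powr p) powr (1 / p) = (2 * C) powr (1 / p) * ?b"
    using b assms by (simp add: powr_mult powr_powr)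
  also have "((1 + sqn y) powr p) powr (1 / p) = 1 + sqn y"
    using s assms by (simp add: powr_powr)
  finally have "sqn y < (2 * C) powr (1 / p) * ?b" by simp
  also have "\<dots> \<le> (2 * C) powr (1 / p) * (13 / 4 * (real n)\<^sup>2)"
    using assms(3) by (intro mult_left_mono) auto
  also have "\<dots> \<le> (real K)\<^sup>2 * (real n)\<^sup>2"
    using mult_right_mono[OF assms(4), of "(real n)\<^sup>2"] by (simp add: mult.assoc)
  finally have *: "sqn y < (real (K * n))\<^sup>2" by (simp add: power_mult_distrib)
  then have "0 < real (K * n)" using sqn_nonneg[of y] by (cases "K * n = 0") auto
  with * have "y \<in> lattice_ball (real (K * n))" by (simp only: lattice_ball_iff)
  then show ?thesis using lattice_ball_subset_cube by blast
qed

text \<open>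
  The initial weight and the least final weight are exponential in \<open>n\<close>. With \<open>\<tau>\<close> of order \<open>n powr (1 - d)\<close>, every initial particle contributes at
  least \<open>c * \<tau>\<close> to the exponent, in total of order \<open>\<alpha> * n\<close>. A stable configuration that misses \<open>z\<close>
  contributes at most the sum of \<open>2 * c * g\<close> over the support of the truncation, of order \<open>n\<close> without \<open>\<alpha>\<close>.
\<close>

lemma prob_site_empty_upper:
  assumes "offspring_law \<nu>" "2 < CARD('d::finite)"
  shows "\<exists>c2>0. \<exists>c3>0. \<forall>\<alpha> n. \<forall>\<eta> :: 'd config. \<forall>r z. 0 < \<alpha> \<longrightarrow> 1 \<le> n \<longrightarrow> linear_order r \<longrightarrow>
    {z. \<eta> z > 0} \<subseteq> lattice_ball (real n / 2) \<longrightarrow>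
    \<alpha> * real (card (lattice_ball (real n) :: 'd site set)) \<le> real (num_particles \<eta>) \<longrightarrow> z \<in> lattice_ball (real n) \<longrightarrow>
    prob_site_empty \<nu> r \<eta> z \<le> exp (c3 * real n - c2 * \<alpha> * real n)"
proof -
  let ?d = "CARD('d)"
  define p where "p = (real ?d - 1) / 2"
  have p: "0 < p" using assms by (simp add: p_def)
  obtain g :: "'d site \<Rightarrow> real" and \<delta> C where g: "0 < \<delta>" "1 \<le> C"
    "\<And>x. x \<noteq> 0 \<Longrightarrow> g x + \<delta> * (avg g x)\<^sup>2 \<le> avg g x"
    "\<And>x. decay p x \<le> g x" "\<And>x. g x \<le> C * decay p x"
    using potential_exists[OF assms(2) p_def] by metis
  have g0: "0 \<le> g x" "g x \<le> C" for x
  proof -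
    show "0 \<le> g x" using g(4)[of x] decay_pos[of p x] by linarith
    have "C * decay p x \<le> C * 1" using g(2) decay_le_1[of p x] p by (intro mult_left_mono) auto
    then show "g x \<le> C" using g(5)[of x] by linarith
  qed
  obtain S where S: "1 \<le> S" "\<And>s. 0 \<le> s \<Longrightarrow> s \<le> 1 \<Longrightarrow> pgf \<nu> (1 - s) \<le> 1 - s + S * s\<^sup>2"
    using pgf_upper_bound[OF assms(1)] by metis
  define c where "c = min (1 / (2 * C)) (\<delta> / S)"
  have c: "0 < c" "c \<le> 1 / (2 * C)" "c \<le> \<delta> / S" using g S by (auto simp: c_def)
  obtain K0 :: nat where K0: "(2 * C) powr (1 / p) * (13 / 4) \<le> real K0" using real_arch_simple by blast
  define K where "K = Suc K0"
  have "real K0 \<le> real K * real K" unfolding K_def by (simp add: algebra_simps)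
  then have K: "(2 * C) powr (1 / p) * (13 / 4) \<le> (real K)\<^sup>2" using K0 by (simp add: power2_eq_square)
  define c2 where "c2 = c * ((13 / 4) powr (-p) / 2) / (real ?d + 1) ^ ?d"
  define c3 where "c3 = 2 * c * C * (4 * real ?d) ^ ?d * (real K + 1)"
  have pos: "0 < c2" "0 < c3" using c g(2) by (auto simp: c2_def c3_def)
  have "prob_site_empty \<nu> r \<eta> z \<le> exp (c3 * real n - c2 * \<alpha> * real n)"
    if \<alpha>: "0 < \<alpha>" and n: "1 \<le> n" and r: "linear_order r"
      and supp: "{z. \<eta> z > 0} \<subseteq> lattice_ball (real n / 2)"
      and num: "\<alpha> * real (card (lattice_ball (real n) :: 'd site set)) \<le> real (num_particles \<eta>)"
      and z: "z \<in> lattice_ball (real n)"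
    for \<alpha> n r z and \<eta> :: "'d config"
  proof -
    let ?b = "1 + 9 / 4 * (real n)\<^sup>2"
    \<comment> \<open>Half the smallest value of \<open>decay p (x - z)\<close> over starting points \<open>x\<close>, as \<open>\<parallel>x - z\<parallel> \<le> 3 * n / 2\<close>.\<close>
    define \<tau> where "\<tau> = ?b powr (-p) / 2"
    have b: "0 < ?b" by (simp add: add_pos_nonneg)
    have \<tau>: "0 < \<tau>" using b by (simp add: \<tau>_def)
    define u where "u x = (if x = z then 0 else 1 - c * max 0 (g (x - z) - \<tau>))" for x
    note sub = subsolution[OF g(1-3) g0 S c \<tau> u_def]
    define D where "D = {x. x \<noteq> z \<and> \<tau> < g (x - z)}"
    have Dsub: "(\<lambda>x. x - z) ` D \<subseteq> cube (K * n)"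
    proof clarify
      fix x assume "x \<in> D"
      then have "\<tau> < C * decay p (x - z)" using g(5)[of "x - z"] by (simp add: D_def)
      then show "x - z \<in> cube (K * n)"
        unfolding \<tau>_def by (intro decay_level_set[OF p g(2) n K])
    qed
    have inj: "inj_on (\<lambda>x. x - z) D" by (simp add: inj_on_def)
    have finD: "finite D"
      using finite_imageD[OF finite_subset[OF Dsub finite_cube] inj] .
    have sumD: "(\<Sum>x\<in>D. g (x - z)) \<le> C * ((4 * real ?d) ^ ?d * ((real K + 1) * real n))"
    proof -
      have "(\<Sum>x\<in>D. g (x - z)) = (\<Sum>y\<in>(\<lambda>x. x - z) ` D. g y)"
        using inj by (simp add: sum.reindex)
      also have "\<dots> \<le> (\<Sum>y\<in>cube (K * n). g y)"
        using Dsub g0 by (intro sum_mono2) auto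
      also have "\<dots> \<le> (\<Sum>y\<in>(cube (K * n) :: 'd site set). C * decay p y)" by (intro sum_mono g(5))
      also have "\<dots> = C * (\<Sum>y\<in>(cube (K * n) :: 'd site set). decay p y)" by (simp add: sum_distrib_left)
      also have "\<dots> \<le> C * ((4 * real ?d) ^ ?d * (real (K * n) + 1))"
        using g(2) by (intro mult_left_mono sum_cube_decay_le p_def) auto
      also have "\<dots> \<le> C * ((4 * real ?d) ^ ?d * ((real K + 1) * real n))"
        using g(2) n by (intro mult_left_mono) (auto simp: algebra_simps)
      finally show ?thesis .
    qed
    have prodD: "exp (- (c3 * real n)) \<le> (\<Prod>x\<in>D. u x)"
    proof -
      have "2 * c * (\<Sum>x\<in>D. g (x - z)) \<le> 2 * c * (C * ((4 * real ?d) ^ ?d * ((real K + 1) * real n)))"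
        using sumD c by (intro mult_left_mono) auto
      also have "\<dots> = c3 * real n" by (simp add: c3_def)
      finally have "exp (- (c3 * real n)) \<le> exp (\<Sum>x\<in>D. - (2 * c * g (x - z)))"
        by (simp add: sum_negf sum_distrib_left)
      also have "\<dots> = (\<Prod>x\<in>D. exp (- (2 * c * g (x - z))))" using finD by (rule exp_sum)
      also have "\<dots> \<le> (\<Prod>x\<in>D. u x)" by (intro prod_mono conjI sub(4)) (auto simp: D_def)
      finally show ?thesis .
    qed
    have "prob_site_empty \<nu> r \<eta> z \<le> weight u \<eta> / exp (- (c3 * real n))"
    proof (rule prob_site_empty_le[OF assms(1) r finite_config_in_ball[OF supp] sub(1,2) _ sub(3) finD _ _ _ prodD])
      show "u x = 1" if "x \<noteq> z" "x \<notin> D" for x using that by (simp add: u_def D_def)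
    qed (auto simp: u_def D_def)
    also have "weight u \<eta> \<le> exp (- (c2 * \<alpha> * real n))"
    proof -
      have "weight u \<eta> \<le> weight (\<lambda>_. exp (- (c * \<tau>))) \<eta>"
      proof (rule weight_mono)
        fix x assume "0 < \<eta> x"
        then have x: "x \<in> lattice_ball (real n / 2)" using supp by auto
        have "sqrt (sqn x) < real n / 2" "sqrt (sqn z) < real n"
          using x z by (simp_all add: lattice_ball_iff_sqrt)
        moreover have "sqrt (sqn (x - z)) \<le> sqrt (sqn x) + sqrt (sqn z)"
          using sqn_triangle[of x "- z"] by simp
        ultimately have "sqrt (sqn (x - z)) \<le> 3 / 2 * real n" by linarith
        then have "(sqrt (sqn (x - z)))\<^sup>2 \<le> (3 / 2 * real n)\<^sup>2" by (intro power_mono) auto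
        then have "1 + sqn (x - z) \<le> ?b" by (simp add: power_mult_distrib power_divide)
        then have "?b powr (-p) \<le> decay p (x - z)"
          unfolding decay_def using p by (intro powr_mono2') (auto simp: add_pos_nonneg)
        then have "\<tau> \<le> g (x - z) - \<tau>" using g(4)[of "x - z"] by (simp add: \<tau>_def)
        then have "c * \<tau> \<le> c * max 0 (g (x - z) - \<tau>)" using c by (intro mult_left_mono) auto
        moreover have "1 - c * \<tau> \<le> exp (- (c * \<tau>))" using exp_ge_add_one_self[of "- (c * \<tau>)"] by simp
        ultimately have "u x \<le> exp (- (c * \<tau>))" by (auto simp: u_def)
        then show "0 \<le> u x \<and> u x \<le> exp (- (c * \<tau>))" using sub(1) by simp
      qed
      also have "\<dots> = exp (- (c * \<tau> * real (num_particles \<eta>)))"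
        by (simp add: weight_const mult.commute flip: exp_of_nat_mult)
      also have "\<dots> \<le> exp (- (c2 * \<alpha> * real n))"
      proof -
        let ?h = "(13 / 4) powr (-p) / 2"
        have n0: "0 < real n" using n by simp
        have "(13 / 4 * (real n)\<^sup>2) powr (-p) \<le> ?b powr (-p)"
          using p n b by (intro powr_mono2') (auto simp: one_le_power)
        also have "(13 / 4 * (real n)\<^sup>2) powr (-p) = (13 / 4) powr (-p) * ((real n)\<^sup>2) powr (-p)"
          by (rule powr_mult)
        also have "((real n)\<^sup>2) powr (-p) = 1 / real n ^ (?d - 1)"
        proof -
          have "(real n)\<^sup>2 = real n powr 2" using n0 by simp
          moreover have "2 * (-p) = - real (?d - 1)" using assms(2) by (simp add: p_def of_nat_diff field_simps)
          ultimately have "((real n)\<^sup>2) powr (-p) = real n powr (- real (?d - 1))" by (simp only: powr_powr)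
          also have "\<dots> = 1 / real n ^ (?d - 1)"
            unfolding powr_minus powr_realpow[OF n0] divide_inverse by simp
          finally show ?thesis .
        qed
        finally have \<tau>_ge: "?h / real n ^ (?d - 1) \<le> \<tau>" by (simp add: \<tau>_def)
        have "\<alpha> * (real n / (real ?d + 1)) ^ ?d \<le> \<alpha> * real (card (lattice_ball (real n) :: 'd site set))"
          using \<alpha> n by (intro mult_left_mono card_lattice_ball_ge) auto
        then have N_ge: "\<alpha> * (real n / (real ?d + 1)) ^ ?d \<le> real (num_particles \<eta>)" using num by linarith
        have nd: "real n ^ ?d = real n * real n ^ (?d - 1)"
          using assms(2) by (cases ?d) auto
        have "c2 * \<alpha> * real n = c * (?h / real n ^ (?d - 1)) * (\<alpha> * (real n / (real ?d + 1)) ^ ?d)"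
          using n0 by (simp add: c2_def power_divide nd)
        also have "\<dots> \<le> c * \<tau> * real (num_particles \<eta>)"
          using \<tau>_ge N_ge c \<tau> \<alpha> by (intro mult_mono mult_nonneg_nonneg) auto
        finally show ?thesis by simp
      qed
      finally show ?thesis .
    qed
    finally show ?thesis by (simp add: divide_right_mono exp_diff exp_minus field_simps)
  qed
  then show ?thesis using pos by blast
qed

text \<open>
  For large \<open>\<alpha>\<close> half of the exponent absorbs both the constant \<open>c3\<close> and the number of sites in the union bound.
\<close>

lemma prob_not_filled_upper:
  assumes "offspring_law \<nu>" "2 < CARD('d::finite)"
  shows "\<exists>c>0. \<exists>\<alpha>0>0. \<forall>\<alpha> n. \<forall>\<eta> :: 'd config. \<forall>r. \<alpha>0 \<le> \<alpha> \<longrightarrow> 1 \<le> n \<longrightarrow> linear_order r \<longrightarrow>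
    {z. \<eta> z > 0} \<subseteq> lattice_ball (real n / 2) \<longrightarrow>
    \<alpha> * real (card (lattice_ball (real n) :: 'd site set)) \<le> real (num_particles \<eta>) \<longrightarrow>
    prob_not_filled \<nu> r \<eta> n \<le> exp (- (c * \<alpha> * real n))"
proof -
  let ?d = "CARD('d)"
  obtain c2 c3 where c: "0 < c2" "0 < c3" "\<And>\<alpha> n (\<eta> :: 'd config) r z. 0 < \<alpha> \<Longrightarrow> 1 \<le> n \<Longrightarrow> linear_order r \<Longrightarrow>
    {z. \<eta> z > 0} \<subseteq> lattice_ball (real n / 2) \<Longrightarrow>
    \<alpha> * real (card (lattice_ball (real n) :: 'd site set)) \<le> real (num_particles \<eta>) \<Longrightarrow> z \<in> lattice_ball (real n) \<Longrightarrow>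
    prob_site_empty \<nu> r \<eta> z \<le> exp (c3 * real n - c2 * \<alpha> * real n)"
    using prob_site_empty_upper[OF assms] by blast
  define \<alpha>0 where "\<alpha>0 = 2 * (c3 + 3 * real ?d) / c2"
  have \<alpha>0: "0 < \<alpha>0" using c by (simp add: \<alpha>0_def add_pos_nonneg)
  have "prob_not_filled \<nu> r \<eta> n \<le> exp (- (c2 / 2 * \<alpha> * real n))"
    if \<alpha>: "\<alpha>0 \<le> \<alpha>" and n: "1 \<le> n" and r: "linear_order r"
      and supp: "{z. \<eta> z > 0} \<subseteq> lattice_ball (real n / 2)"
      and num: "\<alpha> * real (card (lattice_ball (real n) :: 'd site set)) \<le> real (num_particles \<eta>)"
    for \<alpha> n r and \<eta> :: "'d config"
  proof -
    let ?B = "lattice_ball (real n) :: 'd site set"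
    have "(0 :: 'd site) \<in> ?B" using n by (simp add: lattice_ball_iff sqn_def)
    then have ne: "?B \<noteq> {}" by blast
    have "prob_not_filled \<nu> r \<eta> n \<le> (\<Sum>z\<in>?B. prob_site_empty \<nu> r \<eta> z)"
      by (rule prob_not_filled_le_sum[OF ne finite_lattice_ball])
    also have "\<dots> \<le> (\<Sum>z\<in>?B. exp (c3 * real n - c2 * \<alpha> * real n))"
      using c(3)[OF _ n r supp num] \<alpha> \<alpha>0 by (intro sum_mono) auto
    also have "\<dots> = real (card ?B) * exp (c3 * real n - c2 * \<alpha> * real n)" by simp
    also have "\<dots> \<le> exp (3 * real ?d * real n) * exp (c3 * real n - c2 * \<alpha> * real n)"
    proof (rule mult_right_mono)
      have "real (card ?B) \<le> (3 * real n) ^ ?d" by (rule card_lattice_ball_le[OF n])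
      also have "\<dots> \<le> exp (3 * real n) ^ ?d"
      proof (rule power_mono)
        show "3 * real n \<le> exp (3 * real n)" using exp_ge_add_one_self[of "3 * real n"] by linarith
      qed simp
      also have "\<dots> = exp (3 * real ?d * real n)" by (simp add: mult_ac flip: exp_of_nat_mult)
      finally show "real (card ?B) \<le> exp (3 * real ?d * real n)" .
    qed simp
    also have "\<dots> = exp ((3 * real ?d + c3) * real n - c2 * \<alpha> * real n)"
      by (simp add: algebra_simps flip: exp_add)
    also have "\<dots> \<le> exp (- (c2 / 2 * \<alpha> * real n))"
    proof -
      have "3 * real ?d + c3 \<le> c2 / 2 * \<alpha>"
        using \<alpha> c by (simp add: \<alpha>0_def field_simps)
      then have "(3 * real ?d + c3) * real n \<le> c2 / 2 * \<alpha> * real n" by (intro mult_right_mono) auto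
      then show ?thesis by simp
    qed
    finally show ?thesis .
  qed
  then show ?thesis using c(1) \<alpha>0 by (intro exI[of _ "c2 / 2"]) auto
qed

text \<open>
  The case \<open>n = 1\<close> needs the exact value 0: an initially occupied origin stays occupied.
\<close>

lemma prob_not_filled_unit_ball:
  fixes \<eta> :: "'d::finite config"
  assumes "offspring_law \<nu>" "linear_order r" "{z. \<eta> z > 0} \<subseteq> lattice_ball (1 / 2)" "0 < num_particles \<eta>"
  shows "prob_not_filled \<nu> r \<eta> 1 \<le> 0"
proof -
  have zero: "x = 0" if "x \<in> lattice_ball \<rho>" "0 < \<rho>" "\<rho> \<le> 1" for x :: "'d site" and \<rho>
  proof (rule ccontr)
    assume "x \<noteq> 0"
    then have "1 \<le> sqn x" by (rule one_le_sqn)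
    moreover have "sqn x < \<rho>\<^sup>2" using that by (simp add: lattice_ball_iff)
    moreover have "\<rho>\<^sup>2 \<le> 1" using that by (simp add: power_le_one)
    ultimately show False by linarith
  qed
  have ball: "lattice_ball (real 1) = {0 :: 'd site}"
    using zero[of _ 1] by (auto simp: lattice_ball_iff sqn_def)
  have fc: "finite_config \<eta>" using finite_config_in_ball[of \<eta> 1] assms(3) by simp
  have "\<exists>x. 0 < \<eta> x"
  proof (rule ccontr)
    assume "\<nexists>x. 0 < \<eta> x"
    then show False using assms(4) by (simp add: num_particles_def)
  qed
  then have "0 < \<eta> 0" using assms(3) zero[of _ "1/2"] by auto
  then have "prob_site_empty \<nu> r \<eta> 0 = 0" by (rule prob_site_empty_occupied[OF assms(1,2) fc])
  then show ?thesis
    using prob_not_filled_le_sum[of 1 \<nu> r \<eta>] ball by simp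
qed

section \<open>The two bounds combined\<close>

theorem lemma1p3:
  fixes \<nu> :: "nat pmf"
  assumes "offspring_law \<nu>"
  shows
    "(CARD('d::finite) > 2 \<longrightarrow>
       (\<exists>C::real. C > 0 \<and> (\<exists>\<alpha>\<^sub>0::real. \<alpha>\<^sub>0 > 0 \<and>
         (\<forall>\<alpha>::real. \<forall>n::nat. \<forall>\<eta> :: 'd config. \<forall>r :: 'd site rel.
            \<alpha> \<ge> \<alpha>\<^sub>0 \<longrightarrow> n \<ge> 1 \<longrightarrow> linear_order r \<longrightarrow>
            {z. \<eta> z > 0} \<subseteq> lattice_ball (real n / 2) \<longrightarrow>
            real (num_particles \<eta>) \<ge> \<alpha> * real (card (lattice_ball (real n) :: 'd site set)) \<longrightarrow>
            prob_not_filled \<nu> r \<eta> n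
              \<le> exp_neg_quot (C * (\<alpha> * real n))
                   (ln (real n) * of_bool (CARD('d) = 3) + of_bool (CARD('d) > 3))))))
     \<and>
     (CARD('d) \<ge> 2 \<longrightarrow>
       (\<exists>c::real. c > 0 \<and> (\<exists>\<alpha>\<^sub>0::real. \<alpha>\<^sub>0 > 0 \<and>
         (\<forall>\<alpha>::real. \<forall>n::nat. \<forall>\<eta> :: 'd config. \<forall>r :: 'd site rel.
            \<alpha> \<ge> \<alpha>\<^sub>0 \<longrightarrow> n \<ge> 1 \<longrightarrow> (n = 1 \<longrightarrow> \<eta> = (\<lambda>_. 0)) \<longrightarrow> linear_order r \<longrightarrow>
            {z. \<eta> z > 0} \<subseteq> lattice_ball (real n / 2) \<longrightarrow>
            real (num_particles \<eta>) \<le> \<alpha> * real (card (lattice_ball (real n) :: 'd site set)) \<longrightarrow>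
            prob_not_filled \<nu> r \<eta> n \<ge> exp (- (c * \<alpha> * real n ^ (CARD('d) - 2)))))))"
proof (intro conjI impI)
  assume d: "CARD('d) > 2"
  obtain c \<alpha>0 where c: "0 < c" "0 < \<alpha>0" "\<And>\<alpha> n (\<eta> :: 'd config) r. \<alpha>0 \<le> \<alpha> \<Longrightarrow> 1 \<le> n \<Longrightarrow> linear_order r \<Longrightarrow>
    {z. \<eta> z > 0} \<subseteq> lattice_ball (real n / 2) \<Longrightarrow>
    \<alpha> * real (card (lattice_ball (real n) :: 'd site set)) \<le> real (num_particles \<eta>) \<Longrightarrow>
    prob_not_filled \<nu> r \<eta> n \<le> exp (- (c * \<alpha> * real n))"
    using prob_not_filled_upper[OF assms d] by blast
  \<comment> \<open>The factor \<open>ln 2\<close> covers \<open>n = 2\<close> for \<open>d = 3\<close>, the only case where \<open>0 < ln n < 1\<close>.\<close>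
  define C where "C = c * min 1 (ln 2)"
  have C: "0 < C" "C \<le> c" "C \<le> c * ln 2" using c by (auto simp: C_def)
  have "prob_not_filled \<nu> r \<eta> n \<le> exp_neg_quot (C * (\<alpha> * real n))
      (ln (real n) * of_bool (CARD('d) = 3) + of_bool (CARD('d) > 3))"
    if \<alpha>: "\<alpha>0 \<le> \<alpha>" and n: "1 \<le> n" and r: "linear_order r"
      and supp: "{z. \<eta> z > 0} \<subseteq> lattice_ball (real n / 2)"
      and num: "\<alpha> * real (card (lattice_ball (real n) :: 'd site set)) \<le> real (num_particles \<eta>)"
    for \<alpha> n r and \<eta> :: "'d config"
  proof -
    have bound: "prob_not_filled \<nu> r \<eta> n \<le> exp (- (c * \<alpha> * real n))" by (rule c(3)[OF that])
    have an: "0 \<le> \<alpha> * real n" using \<alpha> c by simp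
    consider "CARD('d) > 3" | "CARD('d) = 3" "n = 1" | "CARD('d) = 3" "2 \<le> n" using d n by linarith
    then show ?thesis
    proof cases
      case 1
      have "C * (\<alpha> * real n) \<le> c * (\<alpha> * real n)" using C an by (intro mult_right_mono) auto
      then have "exp (- (c * \<alpha> * real n)) \<le> exp (- (C * (\<alpha> * real n)))" by (simp add: mult.assoc)
      from order_trans[OF bound this] show ?thesis using 1 by (simp add: exp_neg_quot_def)
    next
      case 2
      have "(0 :: 'd site) \<in> lattice_ball (real 1)" by (simp add: lattice_ball_iff sqn_def)
      then have "0 < card (lattice_ball (real 1) :: 'd site set)"
        using finite_lattice_ball[where 'd = 'd, of 1] card_gt_0_iff by blast
      then have "0 < \<alpha> * real (card (lattice_ball (real 1) :: 'd site set))" using \<alpha> c by simp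
      then have "0 < num_particles \<eta>" using num 2 by simp
      then have "prob_not_filled \<nu> r \<eta> 1 \<le> 0"
        using prob_not_filled_unit_ball[OF assms r] supp 2 by simp
      then show ?thesis using 2 by (simp add: exp_neg_quot_def)
    next
      case 3
      have ln: "0 < ln (real n)" "ln 2 \<le> ln (real n)" using 3 by auto
      have "C \<le> c * ln (real n)" using C(3) mult_left_mono[OF ln(2), of c] c by linarith
      then have "C * (\<alpha> * real n) \<le> c * ln (real n) * (\<alpha> * real n)" using an by (rule mult_right_mono)
      then have "C * (\<alpha> * real n) / ln (real n) \<le> c * \<alpha> * real n"
        using ln by (simp add: divide_le_eq mult_ac)
      then have "exp (- (c * \<alpha> * real n)) \<le> exp (- (C * (\<alpha> * real n) / ln (real n)))" by simp
      from order_trans[OF bound this] show ?thesis using 3 ln by (simp add: exp_neg_quot_def)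
    qed
  qed
  then show "\<exists>C::real. C > 0 \<and> (\<exists>\<alpha>\<^sub>0::real. \<alpha>\<^sub>0 > 0 \<and>
         (\<forall>\<alpha>::real. \<forall>n::nat. \<forall>\<eta> :: 'd config. \<forall>r :: 'd site rel.
            \<alpha> \<ge> \<alpha>\<^sub>0 \<longrightarrow> n \<ge> 1 \<longrightarrow> linear_order r \<longrightarrow>
            {z. \<eta> z > 0} \<subseteq> lattice_ball (real n / 2) \<longrightarrow>
            real (num_particles \<eta>) \<ge> \<alpha> * real (card (lattice_ball (real n) :: 'd site set)) \<longrightarrow>
            prob_not_filled \<nu> r \<eta> n
              \<le> exp_neg_quot (C * (\<alpha> * real n))
                   (ln (real n) * of_bool (CARD('d) = 3) + of_bool (CARD('d) > 3))))"
    using C(1) c(2) by blast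
next
  assume d: "CARD('d) \<ge> 2"
  obtain c where c: "0 < c" "\<And>\<alpha> n (\<eta> :: 'd config) r. 0 < \<alpha> \<Longrightarrow> 1 \<le> n \<Longrightarrow> (n = 1 \<longrightarrow> \<eta> = (\<lambda>_. 0)) \<Longrightarrow> linear_order r \<Longrightarrow>
    {z. \<eta> z > 0} \<subseteq> lattice_ball (real n / 2) \<Longrightarrow>
    real (num_particles \<eta>) \<le> \<alpha> * real (card (lattice_ball (real n) :: 'd site set)) \<Longrightarrow>
    exp (- (c * \<alpha> * real n ^ (CARD('d) - 2))) \<le> prob_not_filled \<nu> r \<eta> n"
    using prob_not_filled_lower[OF assms d] by blast
  then show "\<exists>c::real. c > 0 \<and> (\<exists>\<alpha>\<^sub>0::real. \<alpha>\<^sub>0 > 0 \<and>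
         (\<forall>\<alpha>::real. \<forall>n::nat. \<forall>\<eta> :: 'd config. \<forall>r :: 'd site rel.
            \<alpha> \<ge> \<alpha>\<^sub>0 \<longrightarrow> n \<ge> 1 \<longrightarrow> (n = 1 \<longrightarrow> \<eta> = (\<lambda>_. 0)) \<longrightarrow> linear_order r \<longrightarrow>
            {z. \<eta> z > 0} \<subseteq> lattice_ball (real n / 2) \<longrightarrow>
            real (num_particles \<eta>) \<le> \<alpha> * real (card (lattice_ball (real n) :: 'd site set)) \<longrightarrow>
            prob_not_filled \<nu> r \<eta> n \<ge> exp (- (c * \<alpha> * real n ^ (CARD('d) - 2)))))"
    by (intro exI[of _ c] conjI exI[of _ 1] allI impI) auto
qed

end
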